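(* Let $R(z)$ be a $p\times p$ self-adjoint rational matrix function with a matrix fraction $R(z)=Q(z)P(z)^{-1}$, $z\notin\sigma(P)$, where $Q(z)$ is a $p\times p$ matrix polynomial and $P(z)$ is a monic $p\times p$ matrix polynomial with $\deg P\ge1$. Suppose that $\mathscr H_{-2,0}(R)\succeq0$, $\mathscr H_{\deg P-1}(R)\prec0$ and $\deg Q-\deg P\le1$. Then (i) $R(z)$ is a matrix-valued Herglotz-Nevanlinna function; (ii) $|\deg Q-\deg P|\le1$; (iii) $P(z)$ is a simple matrix polynomial and $\sigma(P)\subseteq\mathbb R$; (iv) $Q(z)$ and $P(z)$ are right coprime.
   Context: Here $p\in\mathbb N$; $A^*$ is the conjugate transpose; for self-adjoint matrices, $\succ0,\prec0,\succeq0,\preceq0$ mean positive definite, negative definite, nonnegative definite, nonpositive definite. $0_p, I_p$ are the zero and identity $p\times p$ matrices. A $p\times p$ matrix polynomial $F(z)=\sum_{k=0}^n A_kz^{n-k}$ with $A_k\in\mathbb C^{p\times p}$, $A_0\ne0_p$, has degree $\deg F=n$; it is monic if $A_0=I_p$, and regular if $\det F(z)\not\equiv0$. For a regular $F$, $\sigma(F)=\{\lambda\in\mathbb C:\det F(\lambda)=0\}$ (the zeros of $F$). $F$ is simple if it is regular and, for every zero $\lambda$ of $F$, the multiplicity of $\lambda$ (as a root of $\det F$) equals the nullity of the matrix $F(\lambda)$. $G(z)$ is a right divisor of $F(z)$ if $F(z)=C(z)G(z)$ for some matrix polynomial $C(z)$. A right common divisor of $F$ and $\widetilde F$ is a right divisor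 of both; it is a greatest right common divisor (GRCD) if every other right common divisor is a right divisor of it. $F$ and $\widetilde F$ are right coprime if any GRCD of them is unimodular, i.e. its determinant never vanishes in $\mathbb C$. A rational matrix function is a matrix function whose entries are complex rational functions. It is self-adjoint if $R(z)=R(\bar z)^*$ for all $z\in\mathbb C$ except the poles of its entries. $R$ is a matrix-valued Herglotz-Nevanlinna function if it is holomorphic on the open upper half-plane $\mathbb C_+$ and $\frac1{2\mathrm i}(R(z)-R(z)^* )\succeq0$ for all $z\in\mathbb C_+$. Write the Laurent series of $R$ convergent for large $|z|$ as $R(z)=\sum_{j=0}^{k}z^j\mathbf s_{-(j+1)}+\sum_{j=0}^\infty \mathbf s_j z^{-(j+1)}$, with $\mathbf s_{-i}=0_p$ for $i>k+1$. For $j\in\mathbb N_0\cup\{-1,-2\}$ and $k\in\mathbb N_0$, $\mathscr H_{j,k}(R)$ is the block Hankel matrix $[\mathbf s_{j+a+b}]_{a,b=0}^k$, and $\mathscr H_k(R):=\mathscr H_{0,k}(R)$. In particular $\mathscr H_{-2,0}(R)=\mathbf s_{-2}$. *)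

theory Defs
  imports
    "HOL-Complex_Analysis.Complex_Analysis"
    "Jordan_Normal_Form.Schur_Decomposition"
    "Jordan_Normal_Form.Matrix_Kernel"
    "Jordan_Normal_Form.Gauss_Jordan_Elimination"
begin

hide_const (open) Determinants.det

definition self_adjoint_mat :: "complex mat \<Rightarrow> bool" where
  "self_adjoint_mat A \<longleftrightarrow> square_mat A \<and> mat_adjoint A = A"

text \<open>For a self-adjoint matrix the number \<open>(A *\<^sub>v v) \<bullet>c v\<close>, that is \<open>v\<^sup>* A v\<close>, is real,
  so taking its real part loses nothing.\<close>

definition nonneg_def_mat :: "complex mat \<Rightarrow> bool" where
  "nonneg_def_mat A \<longleftrightarrow> self_adjoint_mat A \<and>
     (\<forall>v \<in> carrier_vec (dim_row A). Re ((A *\<^sub>v v) \<bullet>c v) \<ge> 0)"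

definition neg_def_mat :: "complex mat \<Rightarrow> bool" where
  "neg_def_mat A \<longleftrightarrow> self_adjoint_mat A \<and>
     (\<forall>v \<in> carrier_vec (dim_row A). v \<noteq> 0\<^sub>v (dim_row A) \<longrightarrow> Re ((A *\<^sub>v v) \<bullet>c v) < 0)"

text \<open>A \<open>p \<times> p\<close> matrix polynomial is a matrix in \<open>carrier_mat p p\<close> over \<open>complex poly\<close>;
  its coefficient at \<open>z ^ k\<close> is the complex matrix of the \<open>k\<close>-th coefficients of the entries.\<close>

definition mpoly_coeff :: "complex poly mat \<Rightarrow> nat \<Rightarrow> complex mat" where
  "mpoly_coeff F k = map_mat (\<lambda>f. coeff f k) F"

definition mpoly_eval :: "complex poly mat \<Rightarrow> complex \<Rightarrow> complex mat" where
  "mpoly_eval F z = map_mat (\<lambda>f. poly f z) F"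

text \<open>As for \<open>degree\<close> on scalar polynomials, the zero matrix polynomial gets degree \<open>0\<close>.\<close>

definition mpoly_degree :: "complex poly mat \<Rightarrow> nat" where
  "mpoly_degree F = (LEAST n. \<forall>k>n. mpoly_coeff F k = 0\<^sub>m (dim_row F) (dim_col F))"

definition mpoly_monic :: "complex poly mat \<Rightarrow> bool" where
  "mpoly_monic F \<longleftrightarrow> mpoly_coeff F (mpoly_degree F) = 1\<^sub>m (dim_row F)"

definition mpoly_regular :: "complex poly mat \<Rightarrow> bool" where
  "mpoly_regular F \<longleftrightarrow> (\<exists>z. det (mpoly_eval F z) \<noteq> 0)"

definition mpoly_zeros :: "complex poly mat \<Rightarrow> complex set" where
  "mpoly_zeros F = {z. det (mpoly_eval F z) = 0}"

text \<open>\<open>det F\<close> is the scalar polynomial \<open>det F(z)\<close>, and \<open>kernel_dim\<close> is the nullity.\<close>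

definition mpoly_simple :: "complex poly mat \<Rightarrow> bool" where
  "mpoly_simple F \<longleftrightarrow> mpoly_regular F \<and>
     (\<forall>z \<in> mpoly_zeros F. Polynomial.order z (det F) = kernel_dim (mpoly_eval F z))"

definition unimodular :: "complex poly mat \<Rightarrow> bool" where
  "unimodular F \<longleftrightarrow> (\<forall>z. det (mpoly_eval F z) \<noteq> 0)"

definition right_divisor :: "nat \<Rightarrow> complex poly mat \<Rightarrow> complex poly mat \<Rightarrow> bool" where
  "right_divisor p G F \<longleftrightarrow> G \<in> carrier_mat p p \<and> (\<exists>C \<in> carrier_mat p p. F = C * G)"

definition right_common_divisor ::
    "nat \<Rightarrow> complex poly mat \<Rightarrow> complex poly mat \<Rightarrow> complex poly mat \<Rightarrow> bool" where
  "right_common_divisor p G F F' \<longleftrightarrow> right_divisor p G F \<and> right_divisor p G F'"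

definition is_grcd ::
    "nat \<Rightarrow> complex poly mat \<Rightarrow> complex poly mat \<Rightarrow> complex poly mat \<Rightarrow> bool" where
  "is_grcd p G F F' \<longleftrightarrow> right_common_divisor p G F F' \<and>
     (\<forall>D. right_common_divisor p D F F' \<longrightarrow> right_divisor p D G)"

definition right_coprime :: "nat \<Rightarrow> complex poly mat \<Rightarrow> complex poly mat \<Rightarrow> bool" where
  "right_coprime p F F' \<longleftrightarrow> (\<forall>G. is_grcd p G F F' \<longrightarrow> unimodular G)"

text \<open>A rational function is given by its values; since the fraction is reduced, the zeros of \<open>d\<close>
  are precisely the poles (in the sense of \<open>is_pole\<close>), and there the value is irrelevant.\<close>

definition rational_function :: "(complex \<Rightarrow> complex) \<Rightarrow> bool" where
  "rational_function f \<longleftrightarrow>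
     (\<exists>q d. d \<noteq> 0 \<and> coprime q d \<and> (\<forall>z. poly d z \<noteq> 0 \<longrightarrow> f z = poly q z / poly d z))"

definition rational_mat_function :: "nat \<Rightarrow> (complex \<Rightarrow> complex mat) \<Rightarrow> bool" where
  "rational_mat_function p R \<longleftrightarrow> (\<forall>z. R z \<in> carrier_mat p p) \<and>
     (\<forall>a<p. \<forall>b<p. rational_function (\<lambda>z. R z $$ (a, b)))"

definition mat_poles :: "nat \<Rightarrow> (complex \<Rightarrow> complex mat) \<Rightarrow> complex set" where
  "mat_poles p R = {z. \<exists>a<p. \<exists>b<p. is_pole (\<lambda>w. R w $$ (a, b)) z}"

text \<open>Both sides of the equation have to be defined; for rational \<open>R\<close> the condition forces the set
  of poles to be closed under conjugation, so that the requirement on \<open>cnj z\<close> is no restriction.\<close>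

definition self_adjoint_mat_function :: "nat \<Rightarrow> (complex \<Rightarrow> complex mat) \<Rightarrow> bool" where
  "self_adjoint_mat_function p R \<longleftrightarrow>
     (\<forall>z. z \<notin> mat_poles p R \<and> cnj z \<notin> mat_poles p R \<longrightarrow> R z = mat_adjoint (R (cnj z)))"

definition herglotz_nevanlinna :: "nat \<Rightarrow> (complex \<Rightarrow> complex mat) \<Rightarrow> bool" where
  "herglotz_nevanlinna p R \<longleftrightarrow>
     (\<forall>a<p. \<forall>b<p. (\<lambda>z. R z $$ (a, b)) holomorphic_on {z. Im z > 0}) \<and>
     (\<forall>z. Im z > 0 \<longrightarrow> nonneg_def_mat ((1 / (2 * \<i>)) \<cdot>\<^sub>m (R z - mat_adjoint (R z))))"

text \<open>\<open>laurent_mat p R j\<close> is the coefficient \<open>\<^bold>s\<^sub>j\<close> at \<open>z powi (- (j + 1))\<close> of the Laurent series of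
  \<open>R\<close> convergent for large \<open>z\<close>. In the variable \<open>w = 1 / z\<close> this is the coefficient at
  \<open>w powi (j + 1)\<close> of the Laurent expansion of \<open>R (1 / w)\<close> at \<open>0\<close>.\<close>

definition laurent_mat :: "nat \<Rightarrow> (complex \<Rightarrow> complex mat) \<Rightarrow> int \<Rightarrow> complex mat" where
  "laurent_mat p R j =
     mat p p (\<lambda>(a, b). fls_nth (laurent_expansion (\<lambda>w. R (1 / w) $$ (a, b)) 0) (j + 1))"

text \<open>The block at position \<open>(a, b)\<close>, where \<open>0 \<le> a, b \<le> k\<close>, is \<open>laurent_mat p R (j + a + b)\<close>.\<close>

definition block_hankel :: "nat \<Rightarrow> (complex \<Rightarrow> complex mat) \<Rightarrow> int \<Rightarrow> nat \<Rightarrow> complex mat" where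
  "block_hankel p R j k = mat ((k + 1) * p) ((k + 1) * p)
     (\<lambda>(i, l). laurent_mat p R (j + int (i div p) + int (l div p)) $$ (i mod p, l mod p))"

end

theory Submission
  imports Defs "Jordan_Normal_Form.DL_Rank"
begin

text \<open>Let \<open>L\<^sub>a\<^sub>b\<close> be the linear functional on scalar polynomials that sends \<open>f\<close> to the coefficient
  of \<open>R\<^sub>a\<^sub>b f\<close> at \<open>1/z\<close>, and let \<open>[u, v]\<close> be the sum of all \<open>L\<^sub>a\<^sub>b (v\<^sub>a\<^sup>* u\<^sub>b)\<close> for vector
  polynomials \<open>u\<close> and \<open>v\<close>. On vectors of degree less than \<open>n = deg P\<close> its Gram matrix is the block
  Hankel matrix, so there the form is negative definite. Multiplication by \<open>z\<close> is symmetric for it,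
  and \<open>[P y, v] = 0\<close> because \<open>R P = Q\<close> is a polynomial.

  If \<open>P(\<lambda>) x = 0\<close> then \<open>u = P x / (z - \<lambda>)\<close> has degree less than \<open>n\<close> and \<open>x\<close> as its coefficient
  at \<open>z\<^sup>n\<^sup>-\<^sup>1\<close>, and \<open>(z - \<lambda>) u\<close> is orthogonal to everything; hence \<open>\<lambda>\<close> is real. For a Jordan chain
  \<open>x, y\<close> put \<open>g = (P y + u) / (z - \<lambda>)\<close>: then
  \<open>[u, u] = [P y + u, u] = [g, (z - \<lambda>) u] = [g, P x] = 0\<close>, so \<open>x = 0\<close> and \<open>P\<close> is simple.
  If also \<open>Q(\<lambda>) x = 0\<close> then \<open>R u\<close> is a polynomial, so \<open>[u, u] = 0\<close> and again \<open>x = 0\<close>; this gives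
  coprimeness. Finally, for \<open>v = P(\<zeta>) x\<close> and \<open>u = (P - P(\<zeta>)) x / (z - \<zeta>)\<close>, the expansion of \<open>R\<close>
  at infinity gives \<open>v\<^sup>* R(\<zeta>) v = v\<^sup>* (\<zeta> \<^bold>s\<^sub>-\<^sub>2 + \<^bold>s\<^sub>-\<^sub>1) v + [u, v]\<close> with
  \<open>Im [u, v] = - Im \<zeta> [u, u]\<close>, which yields the Herglotz-Nevanlinna property.\<close>

no_notation vec_nth (infixl "$" 90)
no_notation fps_nth (infixl "$" 75)
no_notation fls_nth (infixl "$$" 75)

section \<open>Multiplicity of a zero without Jordan chains\<close>

text \<open>A basis of the kernel is completed to a basis of the whole space, and the columns of
  \<open>T\<close> are the kernel vectors followed by the completion. In these coordinates the
  kernel is spanned by the first \<open>kernel_dim A\<close> unit vectors.\<close>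

lemma kernel_adapted_basis:
  fixes A :: "'a :: field mat"
  assumes A: "A \<in> carrier_mat n n"
  obtains T where "T \<in> carrier_mat n n" "det T \<noteq> 0" "kernel_dim A \<le> n"
    "\<And>v. v \<in> carrier_vec n \<Longrightarrow>
       A *\<^sub>v (T *\<^sub>v v) = 0\<^sub>v n \<longleftrightarrow> (\<forall>i<n. kernel_dim A \<le> i \<longrightarrow> v $ i = 0)"
proof -
  interpret kernel n n A by unfold_locales (rule A)
  obtain B where finB: "finite B" and B: "basis B"
    using kernel_basis_exists[OF A] by blast
  have BK: "B \<subseteq> mat_kernel A" and indB: "NC.lin_indpt B" and spanB: "NC.span B = mat_kernel A"
    using B lindep_same span_same unfolding Ker.basis_def by auto
  have KC: "mat_kernel A \<subseteq> carrier_vec n"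
    using A by (rule mat_kernel_carrier)
  have cardB: "card B = kernel_dim A"
    using Ker.dim_basis[OF finB B] by simp
  have 1: "B \<subseteq> NC.span (set (unit_vecs n))"
    unfolding NC.span_unit_vecs_is_carrier using BK KC by blast
  have 2: "set (unit_vecs n) \<subseteq> carrier_vec n" by (rule unit_vecs_carrier)
  have 3: "card (set (unit_vecs n :: 'a vec list)) = n"
    using distinct_card[OF NC.unit_vecs_distinct] by simp
  \<comment> \<open>Steinitz exchange against the unit vectors bounds the size of the completion
    \<open>C\<close> from above; spanning bounds it from below, so \<open>B \<union> C\<close> has
    exactly \<open>n\<close> elements and is a basis.\<close>
  have "\<exists>C. finite C \<and> C \<subseteq> carrier_vec n \<and> C \<inter> B = {} \<and> int (card C) \<le> int n - int (card B) 
      \<and> NC.span (B \<union> C) = carrier_vec n"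
    using NC.replacement[OF finB finite_set 2 indB 1]
    unfolding NC.span_unit_vecs_is_carrier 3 by fast
  then obtain C where C: "finite C" "C \<subseteq> carrier_vec n" "C \<inter> B = {}"
      "int (card C) \<le> int n - int (card B)" "NC.span (B \<union> C) = carrier_vec n"
    by blast
  obtain bs where bs: "set bs = B" "distinct bs"
    using finite_distinct_list[OF finB] by blast
  obtain cs where cs: "set cs = C" "distinct cs"
    using finite_distinct_list[OF C(1)] by blast
  have BC: "B \<union> C \<subseteq> carrier_vec n" using BK KC C(2) by auto
  have "n \<le> card (B \<union> C)"
    using NC.gen_ge_dim[of "B \<union> C"] finB C(1,5) BC by (simp add: NC.dim_is_n)
  moreover have cardBC: "card (B \<union> C) = card B + card C"
    using C finB by (simp add: card_Un_disjoint Int_commute)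
  ultimately have card: "card B + card C = n" using C(4) by linarith
  have "NC.basis (B \<union> C)"
    using NC.dim_gen_is_basis[of "B \<union> C"] finB C BC card cardBC by (simp add: NC.dim_is_n)
  hence ind: "NC.lin_indpt (B \<union> C)" unfolding NC.basis_def by simp
  define T where "T = mat_of_cols n (bs @ cs)"
  have len: "length bs = kernel_dim A" "length (bs @ cs) = n"
    using bs cs card cardB by (simp_all flip: distinct_card)
  have T: "T \<in> carrier_mat n n" unfolding T_def using len by auto
  have colsT: "cols T = bs @ cs"
    unfolding T_def using BC bs cs by (intro cols_mat_of_cols) auto
  have dist: "distinct (cols T)" unfolding colsT using bs cs C(3) by auto
  have detT: "det T \<noteq> 0"
    using NC.det_rank_iff[OF T] NC.lin_indpt_full_rank[OF T dist] ind bs cs by (simp add: colsT)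
  have inK: "A *\<^sub>v (T *\<^sub>v v) = 0\<^sub>v n"
    if v: "v \<in> carrier_vec n" "\<forall>i<n. kernel_dim A \<le> i \<longrightarrow> v $ i = 0" for v
  proof -
    have colK: "A *\<^sub>v col T j = 0\<^sub>v n" if "j < kernel_dim A" for j
    proof -
      have "col T j = bs ! j" 
        using that len T colsT by (metis carrier_matD(2) cols_length cols_nth length_append nth_append trans_less_add1)
      then have "col T j \<in> mat_kernel A" using that len bs BK by auto
      thus ?thesis using mat_kernelD[OF A] by auto
    qed
    have "(A * T) *\<^sub>v v = 0\<^sub>v n"
    proof (rule eq_vecI)
      fix i assume "i < dim_vec (0\<^sub>v n :: 'a vec)"
      hence i: "i < n" by simp
      have "((A * T) *\<^sub>v v) $ i = (\<Sum>j<n. (A * T) $$ (i, j) * v $ j)"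
        using A T v i by (simp add: scalar_prod_def lessThan_atLeast0 del: assoc_mult_mat_vec)
      also have "\<dots> = 0"
      proof (rule sum.neutral, safe)
        fix j assume j: "j < n"
        show "(A * T) $$ (i, j) * v $ j = 0"
        proof (cases "j < kernel_dim A")
          case True
          have "(A * T) $$ (i, j) = (A *\<^sub>v col T j) $ i" using A T i j by simp
          thus ?thesis using colK[OF True] i by simp
        qed (use v j in auto)
      qed
      finally show "((A * T) *\<^sub>v v) $ i = 0\<^sub>v n $ i" using i by simp
    qed (use A in simp)
    thus ?thesis using A T v by simp
  qed
  have outK: "\<forall>i<n. kernel_dim A \<le> i \<longrightarrow> v $ i = 0"
    if v: "v \<in> carrier_vec n" and 0: "A *\<^sub>v (T *\<^sub>v v) = 0\<^sub>v n" for v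
  proof -
    have "T *\<^sub>v v \<in> mat_kernel A" using 0 T v by (intro mat_kernelI[OF A]) auto
    hence "T *\<^sub>v v \<in> NC.span_list bs"
      using spanB NC.span_list_as_span[of bs] bs BK KC by auto
    then obtain c where "T *\<^sub>v v = NC.lincomb_list c bs"
      by (auto elim: NC.in_span_listE)
    also have "\<dots> = mat_of_cols n bs *\<^sub>v vec (length bs) c"
      using BK KC bs by (intro NC.lincomb_list_as_mat_mult) auto
    finally have Tv: "T *\<^sub>v v = mat_of_cols n bs *\<^sub>v vec (length bs) c" .
    \<comment> \<open>\<open>w\<close> holds the coordinates of \<open>T v\<close> in the kernel
      basis, padded by zeros. Then \<open>T w = T v\<close>, and invertibility of \<open>T\<close>
      forces \<open>v = w\<close>.\<close>
    define w where "w = vec n (\<lambda>i. if i < kernel_dim A then c i else 0)"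
    have w: "w \<in> carrier_vec n" unfolding w_def by simp
    have "T *\<^sub>v w = mat_of_cols n bs *\<^sub>v vec (length bs) c"
    proof (rule eq_vecI)
      fix i assume "i < dim_vec (mat_of_cols n bs *\<^sub>v vec (length bs) c)"
      hence i: "i < n" by simp
      have "(T *\<^sub>v w) $ i = (\<Sum>j<n. if j < kernel_dim A then T $$ (i, j) * c j else 0)"
        using T i w unfolding w_def 
        by (simp add: scalar_prod_def lessThan_atLeast0 if_distrib cong: if_cong)
      also have "\<dots> = (\<Sum>j<kernel_dim A. T $$ (i, j) * c j)"
        using len by (intro sum.mono_neutral_cong_right) auto
      also have "\<dots> = (mat_of_cols n bs *\<^sub>v vec (length bs) c) $ i"
        using i len by (auto simp: scalar_prod_def lessThan_atLeast0 T_def mat_of_cols_def nth_append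
          intro!: sum.cong)
      finally show "(T *\<^sub>v w) $ i = (mat_of_cols n bs *\<^sub>v vec (length bs) c) $ i" .
    qed (use T in simp)
    hence "T *\<^sub>v (v - w) = 0\<^sub>v n" using Tv T v w 
      by (subst mult_minus_distrib_mat_vec[OF T v w]) (use T \<open>T *\<^sub>v w = _\<close> in auto)
    hence "v - w = 0\<^sub>v n"
      using det_0_iff_vec_prod_zero_field[OF T] detT v w by (metis minus_carrier_vec)
    hence "v $ i = w $ i" if "i < n" for i
      using that v w by (metis eq_iff_diff_eq_0 index_minus_vec(1) index_zero_vec(1) carrier_vecD)
    hence "v = w" using v w by auto
    thus ?thesis unfolding w_def by auto
  qed
  show thesis
  proof (rule that[OF T detT])
    show "kernel_dim A \<le> n" using len by simp
    show "A *\<^sub>v (T *\<^sub>v v) = 0\<^sub>v n \<longleftrightarrow> (\<forall>i<n. kernel_dim A \<le> i \<longrightarrow> v $ i = 0)"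
      if "v \<in> carrier_vec n" for v
      using inK[OF that] outK[OF that] by blast
  qed
qed

section \<open>Evaluation and determinants of matrix polynomials\<close>

lemma mpoly_eval_carrier [simp]: "F \<in> carrier_mat m n \<Longrightarrow> mpoly_eval F z \<in> carrier_mat m n"
  by (simp add: mpoly_eval_def)

lemma mpoly_eval_mult:
  "F \<in> carrier_mat l m \<Longrightarrow> G \<in> carrier_mat m n \<Longrightarrow> mpoly_eval (F * G) z = mpoly_eval F z * mpoly_eval G z"
  unfolding mpoly_eval_def by (rule semiring_hom.mat_hom_mult[OF poly_hom.semiring_hom_axioms])

lemma det_mpoly_eval: "det (mpoly_eval F z) = poly (det F) z"
  unfolding mpoly_eval_def by (rule comm_ring_hom.hom_det[OF poly_hom.comm_ring_hom_axioms])

lemma mult_unit_vec_is_col: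
  fixes A :: "'a :: comm_semiring_1 mat"
  assumes "A \<in> carrier_mat m n" "j < n"
  shows "A *\<^sub>v unit_vec n j = col A j"
  using assms by (intro eq_vecI) (auto simp: col_def)

lemma det_mat_diag: "det (mat_diag n f) = (\<Prod>i<n. f i)"
  for f :: "nat \<Rightarrow> 'a :: idom"
proof -
  have "det (mat_diag n f) = prod_list (diag_mat (mat_diag n f))"
    by (rule det_upper_triangular[of _ n]) (auto simp: mat_diag_def)
  also have "diag_mat (mat_diag n f) = map f [0..<n]"
    by (simp add: diag_mat_def mat_diag_def)
  finally show ?thesis
    by (simp add: prod.list_conv_set_nth lessThan_atLeast0)
qed

text \<open>With \<open>T\<close> adapted to the kernel of \<open>F(z)\<close>, one has \<open>F T = M diag((x - z) I\<^sub>r, I)\<close> where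
  \<open>r\<close> is the nullity of \<open>F(z)\<close>; a null vector of \<open>M(z)\<close> would yield a Jordan chain of length two.\<close>

lemma order_det_eq_kernel_dim:
  fixes F :: "complex poly mat"
  assumes F: "F \<in> carrier_mat p p" and det: "det F \<noteq> 0"
    and no_chain: "\<And>x y. x \<in> carrier_vec p \<Longrightarrow> y \<in> carrier_vec p \<Longrightarrow>
      mpoly_eval F z *\<^sub>v x = 0\<^sub>v p \<Longrightarrow>
      mpoly_eval (map_mat pderiv F) z *\<^sub>v x + mpoly_eval F z *\<^sub>v y = 0\<^sub>v p \<Longrightarrow> x = 0\<^sub>v p"
  shows "Polynomial.order z (det F) = kernel_dim (mpoly_eval F z)"
proof -
  define A where "A = mpoly_eval F z"
  define A' where "A' = mpoly_eval (map_mat pderiv F) z"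
  define r where "r = kernel_dim A"
  have A: "A \<in> carrier_mat p p" and A': "A' \<in> carrier_mat p p" using F by (simp_all add: A_def A'_def)
  obtain T where T: "T \<in> carrier_mat p p" and detT: "det T \<noteq> 0" and r: "r \<le> p"
    and ker: "\<And>v. v \<in> carrier_vec p \<Longrightarrow>
       A *\<^sub>v (T *\<^sub>v v) = 0\<^sub>v p \<longleftrightarrow> (\<forall>i<p. r \<le> i \<longrightarrow> v $ i = 0)"
    using kernel_adapted_basis[OF A] unfolding r_def by blast
  have const: "comm_ring_hom (\<lambda>c :: complex. [:c:])"
    by unfold_locales (auto simp: one_pCons)
  define C where "C = map_mat (\<lambda>c. [:c:]) T"
  have C: "C \<in> carrier_mat p p" using T by (simp add: C_def)
  have entry: "(F * C) $$ (i, j) = (\<Sum>k<p. Polynomial.smult (T $$ (k, j)) (F $$ (i, k)))"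
    if "i < p" "j < p" for i j
    using that F T by (simp add: C_def scalar_prod_def lessThan_atLeast0)
  have evalF: "poly ((F * C) $$ (i, j)) z = (\<Sum>k<p. A $$ (i, k) * T $$ (k, j))"
    if "i < p" "j < p" for i j
    using that F by (simp add: entry poly_sum A_def mpoly_eval_def mult.commute)
  have evalF': "poly (pderiv ((F * C) $$ (i, j))) z = (\<Sum>k<p. A' $$ (i, k) * T $$ (k, j))"
    if "i < p" "j < p" for i j
    using that F by (simp add: entry pderiv_sum pderiv_smult poly_sum A'_def mpoly_eval_def mult.commute)
  \<comment> \<open>The first \<open>r\<close> columns of \<open>T\<close> lie in the kernel of
    \<open>A\<close>, so the first \<open>r\<close> columns of \<open>F * C\<close> vanish at
    \<open>z\<close> and are exactly divisible by \<open>[:- z, 1:]\<close>.\<close>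
  define M where "M = mat p p (\<lambda>(i, j). if j < r then synthetic_div ((F * C) $$ (i, j)) z
    else (F * C) $$ (i, j))"
  have M: "M \<in> carrier_mat p p" by (simp add: M_def)
  have col_r: "synthetic_div ((F * C) $$ (i, j)) z * [:- z, 1:] = (F * C) $$ (i, j)"
    if ij: "i < p" "j < p" and "j < r" for i j
  proof -
    have "A *\<^sub>v (T *\<^sub>v unit_vec p j) = 0\<^sub>v p"
      using ker[of "unit_vec p j"] \<open>j < r\<close> by auto
    hence "A *\<^sub>v col T j = 0\<^sub>v p"
      using T ij by (simp add: mult_unit_vec_is_col)
    moreover have "(A *\<^sub>v col T j) $ i = (\<Sum>k<p. A $$ (i, k) * T $$ (k, j))"
      using A T ij by (simp add: scalar_prod_def lessThan_atLeast0)
    ultimately have "poly ((F * C) $$ (i, j)) z = 0" using ij by (simp add: evalF)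
    thus ?thesis
      using synthetic_div_correct'[of z "(F * C) $$ (i, j)"] by (simp add: mult.commute)
  qed
  have "F * C = M * mat_diag p (\<lambda>j. if j < r then [:- z, 1:] else 1)"
    unfolding mat_diag_mult_right[OF M] using F C
    by (intro eq_matI) (auto simp: M_def col_r simp del: mult_pCons_right index_mult_mat(1))
  hence "det F * det C = det M * (\<Prod>j<p. if j < r then [:- z, 1:] else 1)"
    using det_mult[OF F C] det_mult[OF M, of "mat_diag p _"] by (simp add: det_mat_diag)
  also have "(\<Prod>j<p. if j < r then [:- z, 1:] else 1) = (\<Prod>j<r. [:- z, 1:])"
    using r by (intro prod.mono_neutral_cong_right) auto
  finally have detM: "Polynomial.smult (det T) (det F) = det M * [:- z, 1:] ^ r"
    by (simp add: C_def comm_ring_hom.hom_det[OF const] mult.commute)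
  have "det (mpoly_eval M z) \<noteq> 0"
  proof
    assume "det (mpoly_eval M z) = 0"
    then obtain w where w: "w \<in> carrier_vec p" "w \<noteq> 0\<^sub>v p" and Mw: "mpoly_eval M z *\<^sub>v w = 0\<^sub>v p"
      using det_0_iff_vec_prod_zero_field[of "mpoly_eval M z" p] M by auto
    \<comment> \<open>At \<open>z\<close> the first \<open>r\<close> columns of \<open>M\<close> are
      those of \<open>A' * T\<close>, the others those of \<open>A * T\<close>. Splitting
      \<open>w\<close> accordingly turns \<open>M(z) w = 0\<close> into the chain equation for
      \<open>T w1\<close> and \<open>T w2\<close>.\<close>
    define w1 where "w1 = vec p (\<lambda>j. if j < r then w $ j else 0)"
    define w2 where "w2 = vec p (\<lambda>j. if j < r then 0 else w $ j)"
    have w12: "w1 \<in> carrier_vec p" "w2 \<in> carrier_vec p" by (simp_all add: w1_def w2_def)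
    have Tw: "T *\<^sub>v w1 \<in> carrier_vec p" "T *\<^sub>v w2 \<in> carrier_vec p" using T w12 by auto
    have "A *\<^sub>v (T *\<^sub>v w1) = 0\<^sub>v p" using ker[OF w12(1)] by (simp add: w1_def)
    moreover have "A' *\<^sub>v (T *\<^sub>v w1) + A *\<^sub>v (T *\<^sub>v w2) = 0\<^sub>v p"
    proof (rule eq_vecI)
      fix i assume "i < dim_vec (0\<^sub>v p :: complex vec)"
      hence i: "i < p" by simp
      have "(A' *\<^sub>v (T *\<^sub>v w1) + A *\<^sub>v (T *\<^sub>v w2)) $ i = ((A' * T) *\<^sub>v w1 + (A * T) *\<^sub>v w2) $ i"
        using A A' T w12 by simp
      also have "\<dots> = (\<Sum>j<p. (\<Sum>k<p. A' $$ (i, k) * T $$ (k, j)) * w1 $ j)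
          + (\<Sum>j<p. (\<Sum>k<p. A $$ (i, k) * T $$ (k, j)) * w2 $ j)"
        using A A' T w12 i by (simp add: scalar_prod_def lessThan_atLeast0 del: assoc_mult_mat_vec)
      also have "\<dots> = (\<Sum>j<p. poly (M $$ (i, j)) z * w $ j)"
        unfolding sum.distrib[symmetric]
      proof (intro sum.cong refl)
        fix j assume "j \<in> {..<p}"
        hence j: "j < p" by simp
        show "(\<Sum>k<p. A' $$ (i, k) * T $$ (k, j)) * w1 $ j + (\<Sum>k<p. A $$ (i, k) * T $$ (k, j)) * w2 $ j
            = poly (M $$ (i, j)) z * w $ j"
        proof (cases "j < r")
          case True
          \<comment> \<open>By the product rule the derivative of \<open>(X - z) s\<close> at
            \<open>z\<close> is \<open>s(z)\<close>, so the divided column at \<open>z\<close> is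
            the derivative of the original one.\<close>
          have "poly (pderiv (synthetic_div ((F * C) $$ (i, j)) z * [:- z, 1:])) z
              = poly (synthetic_div ((F * C) $$ (i, j)) z) z"
            by (simp add: pderiv_mult pderiv_pCons del: mult_pCons_right)
          thus ?thesis unfolding col_r[OF i j True] evalF'[OF i j]
            using i j True by (simp add: M_def w1_def w2_def)
        next
          case False
          thus ?thesis unfolding evalF[OF i j, symmetric]
            using i j by (simp add: M_def w1_def w2_def)
        qed
      qed
      also have "\<dots> = (mpoly_eval M z *\<^sub>v w) $ i"
        using M w i by (simp add: mpoly_eval_def scalar_prod_def lessThan_atLeast0)
      finally show "(A' *\<^sub>v (T *\<^sub>v w1) + A *\<^sub>v (T *\<^sub>v w2)) $ i = 0\<^sub>v p $ i"
        using Mw i by simp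
    qed (use A in simp)
    ultimately have Tw1: "T *\<^sub>v w1 = 0\<^sub>v p"
      using no_chain[OF Tw] by (simp add: A_def A'_def)
    hence w1: "w1 = 0\<^sub>v p"
      using det_0_iff_vec_prod_zero_field[OF T] detT w12(1) by blast
    \<comment> \<open>With \<open>w1 = 0\<close> the chain equation puts \<open>T w2\<close> into
      the kernel of \<open>A\<close>, so only the first \<open>r\<close> coordinates of
      \<open>w2\<close> could be nonzero; those vanish by construction.\<close>
    have "A' *\<^sub>v 0\<^sub>v p = 0\<^sub>v p" using A' by (intro eq_vecI) auto
    hence "A *\<^sub>v (T *\<^sub>v w2) = 0\<^sub>v p"
      using \<open>A' *\<^sub>v (T *\<^sub>v w1) + A *\<^sub>v (T *\<^sub>v w2) = 0\<^sub>v p\<close> Tw1 A A' T w12 by simp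
    hence w2: "\<forall>i<p. r \<le> i \<longrightarrow> w2 $ i = 0" using ker[OF w12(2)] by blast
    have "w $ i = 0" if "i < p" for i
    proof (cases "i < r")
      case True
      thus ?thesis using arg_cong[OF w1, of "\<lambda>v. v $ i"] that by (simp add: w1_def)
    next
      case False
      thus ?thesis using w2 that by (simp add: w2_def)
    qed
    hence "w = 0\<^sub>v p" using w(1) by (intro eq_vecI) auto
    thus False using w(2) by simp
  qed
  hence "poly (det M) z \<noteq> 0" by (simp add: det_mpoly_eval)
  \<comment> \<open>\<open>det M\<close> does not vanish at \<open>z\<close>, so the whole order
    comes from the factor with exponent \<open>r\<close>.\<close>
  moreover from this have "Polynomial.order z (det M * [:- z, 1:] ^ r) = Polynomial.order z (det M) + r"
    by (subst order_mult) (auto simp: order_power_n_n simp del: mult_pCons_left)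
  ultimately have "Polynomial.order z (Polynomial.smult (det T) (det F)) = r"
    unfolding detM by (simp add: order_0I)
  thus ?thesis using detT by (simp add: order_smult r_def A_def)
qed

section \<open>Polynomials as Laurent series at infinity\<close>

text \<open>The series variable is \<open>w = 1 / z\<close>, so \<open>z\<close> becomes
  \<open>fls_X_inv\<close>. This embeds the polynomials in \<open>z\<close> into a field that also
  contains the expansion of \<open>R\<close> at infinity.\<close>

definition poly_at_infinity :: "complex poly \<Rightarrow> complex fls" where
  "poly_at_infinity f = poly (map_poly fls_const f) fls_X_inv"

lemma poly_at_infinity_0 [simp]: "poly_at_infinity 0 = 0"
  by (simp add: poly_at_infinity_def)

lemma poly_at_infinity_pCons:
  "poly_at_infinity (pCons a f) = fls_const a + fls_X_inv * poly_at_infinity f"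
  by (cases "a = 0 \<and> f = 0") (auto simp: poly_at_infinity_def map_poly_pCons)

lemma poly_at_infinity_add: "poly_at_infinity (f + g) = poly_at_infinity f + poly_at_infinity g"
  by (induction f g rule: poly_induct2)
     (simp_all add: poly_at_infinity_pCons algebra_simps flip: fls_plus_const)

lemma poly_at_infinity_smult: "poly_at_infinity (Polynomial.smult c f) = fls_const c * poly_at_infinity f"
  by (induction f) (simp_all add: poly_at_infinity_pCons algebra_simps fls_const_mult_const)

lemma poly_at_infinity_mult: "poly_at_infinity (f * g) = poly_at_infinity f * poly_at_infinity g"
  by (induction f)
     (simp_all add: poly_at_infinity_pCons poly_at_infinity_add poly_at_infinity_smult algebra_simps)

lemma poly_at_infinity_const: "poly_at_infinity [:c:] = fls_const c"
  by (simp add: poly_at_infinity_pCons)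

lemma poly_at_infinity_sum: "poly_at_infinity (sum f A) = (\<Sum>x\<in>A. poly_at_infinity (f x))"
  by (induction A rule: infinite_finite_induct) (simp_all add: poly_at_infinity_add)

lemma fls_nth_X_inv_times: "fls_nth (fls_X_inv * F) i = fls_nth F (i + 1)"
  for F :: "'a :: semiring_1 fls"
  by (simp add: fls_X_inv_times_conv_shift)

text \<open>Multiplication by \<open>z ^ k\<close> shifts coefficients by \<open>k\<close> places.
  Any bound \<open>n\<close> of the degree is allowed, so that different polynomials can share one
  range of summation.\<close>

lemma fls_nth_times_poly_at_infinity:
  assumes "degree f \<le> n"
  shows "fls_nth (F * poly_at_infinity f) i = (\<Sum>k\<le>n. coeff f k * fls_nth F (i + int k))"
  using assms
proof (induction f arbitrary: n i)
  case (pCons a f)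
  have X: "fls_nth (F * poly_at_infinity (pCons a f)) i
      = a * fls_nth F i + fls_nth (F * poly_at_infinity f) (i + 1)"
    using fls_nth_X_inv_times[of "F * poly_at_infinity f" i]
    by (simp add: poly_at_infinity_pCons algebra_simps)
  show ?case
  proof (cases "f = 0")
    case True
    have "(\<Sum>k\<le>n. coeff [:a:] k * fls_nth F (i + int k)) = (\<Sum>k\<in>{0}. coeff [:a:] k * fls_nth F (i + int k))"
      by (rule sum.mono_neutral_right) (auto simp: coeff_pCons split: nat.splits)
    thus ?thesis using X True by simp
  next
    case False
    then obtain m where m: "n = Suc m" "degree f \<le> m" using pCons by (cases n) auto
    show ?thesis
      unfolding X m pCons.IH[OF m(2)] by (simp only: sum.atMost_Suc_shift) (simp add: algebra_simps)
  qed
qed simp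

lemma fls_nth_poly_at_infinity:
  "fls_nth (poly_at_infinity f) i = (if i \<le> 0 then coeff f (nat (- i)) else 0)"
proof (induction f arbitrary: i)
  case (pCons a f)
  show ?case
    by (auto simp: poly_at_infinity_pCons fls_nth_X_inv_times pCons coeff_pCons nat_diff_distrib
        split: nat.splits)
qed simp

lemma poly_at_infinity_eq_0_iff [simp]: "poly_at_infinity f = 0 \<longleftrightarrow> f = 0"
proof
  assume "poly_at_infinity f = 0"
  hence "coeff f k = 0" for k
    using fls_nth_poly_at_infinity[of f "- int k"] by simp
  thus "f = 0" by (simp add: poly_eq_iff)
qed simp

lemma has_laurent_expansion_poly_at_infinity:
  "(\<lambda>w. poly f (1 / w)) has_laurent_expansion poly_at_infinity f"
proof (induction f)
  case (pCons a f)
  have "(\<lambda>w. a + inverse w * poly f (1 / w)) has_laurent_expansion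
      (fls_const a + fls_X_inv * poly_at_infinity f)"
    by (intro laurent_expansion_intros pCons)
  thus ?case by (simp add: poly_at_infinity_pCons field_simps)
qed simp

section \<open>Conjugation of the coefficients of a scalar polynomial\<close>

abbreviation cnj_poly :: "complex poly \<Rightarrow> complex poly" where
  "cnj_poly \<equiv> map_poly cnj"

lemma coeff_cnj_poly: "coeff (cnj_poly f) k = cnj (coeff f k)"
  by (simp add: coeff_map_poly)

lemma cnj_poly_cnj_poly [simp]: "cnj_poly (cnj_poly f) = f"
  by (simp add: poly_eq_iff coeff_cnj_poly)

lemma cnj_poly_mult: "cnj_poly (f * g) = cnj_poly f * cnj_poly g"
  by (simp add: poly_eq_iff coeff_cnj_poly coeff_mult)

lemma cnj_poly_pCons: "cnj_poly (pCons a f) = pCons (cnj a) (cnj_poly f)"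
  by (cases "a = 0 \<and> f = 0") (auto simp: map_poly_pCons)

lemma poly_cnj_poly: "poly (cnj_poly f) z = cnj (poly f (cnj z))"
  by (induction f) (simp_all add: map_poly_pCons)

section \<open>The Hankel form of a matrix fraction\<close>

lemma Im_eq_0_if_cnj_eq: "cnj w = w \<Longrightarrow> Im w = 0"
  by (simp add: complex_eq_iff)

text \<open>The entries \<open>S a b\<close> are Laurent series in \<open>w = 1 / z\<close>, so \<open>\<^bold>s\<^sub>j\<close> is the coefficient at \<open>j + 1\<close>
  and the coefficient at \<open>1\<close> extracted below is that of \<open>1 / z\<close>.\<close>

definition hankel_form ::
    "nat \<Rightarrow> (nat \<Rightarrow> nat \<Rightarrow> complex fls) \<Rightarrow> (nat \<Rightarrow> complex poly) \<Rightarrow> (nat \<Rightarrow> complex poly) \<Rightarrow> complex" where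
  "hankel_form p S u v =
     (\<Sum>a<p. \<Sum>b<p. fls_nth (S a b * poly_at_infinity (cnj_poly (v a) * u b)) 1)"

lemma fls_nth_sum: "fls_nth (sum f A) i = (\<Sum>x\<in>A. fls_nth (f x) i)"
  by (induction A rule: infinite_finite_induct) simp_all

lemma hankel_form_add_left:
  "hankel_form p S (\<lambda>b. u b + w b) v = hankel_form p S u v + hankel_form p S w v"
  by (simp add: hankel_form_def poly_at_infinity_add algebra_simps sum.distrib)

lemma hankel_form_smult_left:
  "hankel_form p S (\<lambda>b. Polynomial.smult c (u b)) v = c * hankel_form p S u v"
proof -
  have "fls_nth (S a b * poly_at_infinity (cnj_poly (v a) * Polynomial.smult c (u b))) 1
      = c * fls_nth (S a b * poly_at_infinity (cnj_poly (v a) * u b)) 1" for a b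
  proof -
    have eq: "S a b * poly_at_infinity (cnj_poly (v a) * Polynomial.smult c (u b))
        = fls_const c * (S a b * poly_at_infinity (cnj_poly (v a) * u b))"
      by (simp add: poly_at_infinity_smult mult_ac)
    show ?thesis unfolding eq by simp
  qed
  thus ?thesis by (simp add: hankel_form_def sum_distrib_left)
qed

text \<open>The form depends only on the products \<open>cnj_poly (v a) * u b\<close>, so a scalar
  factor may change sides. For real \<open>q\<close>, in particular for the variable itself,
  multiplication is symmetric.\<close>

lemma hankel_form_mult_left:
  "hankel_form p S (\<lambda>b. q * u b) v = hankel_form p S u (\<lambda>a. cnj_poly q * v a)"
  by (simp add: hankel_form_def cnj_poly_mult mult_ac)

lemma hankel_form_cong:
  assumes "\<And>b. b < p \<Longrightarrow> u b = u' b" "\<And>a. a < p \<Longrightarrow> v a = v' a"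
  shows "hankel_form p S u v = hankel_form p S u' v'"
  using assms by (simp add: hankel_form_def)

text \<open>Summing over \<open>b\<close> first isolates \<open>R u\<close>. The form therefore
  vanishes once \<open>R u\<close> is a polynomial, since a product of polynomials has no term in
  \<open>1 / z\<close>.\<close>

lemma hankel_form_altdef:
  "hankel_form p S u v =
     (\<Sum>a<p. fls_nth (poly_at_infinity (cnj_poly (v a)) * (\<Sum>b<p. S a b * poly_at_infinity (u b))) 1)"
  by (simp add: hankel_form_def fls_nth_sum sum_distrib_left poly_at_infinity_mult mult_ac)

lemma fls_nth_poly_at_infinity_mult_1:
  "fls_nth (poly_at_infinity f * poly_at_infinity g) 1 = 0"
  by (simp add: fls_nth_poly_at_infinity flip: poly_at_infinity_mult)

text \<open>The hypotheses are restated for formal Laurent series, free of analysis. The index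
  \<open>- 1\<close> in \<open>leading_nonneg\<close> belongs to the power \<open>z\<close>, hence
  to s_{-2}; \<open>hankel_neg\<close> is negative definiteness of the Hankel matrix, read on vector
  polynomials of degree below \<open>n\<close>.\<close>

locale hankel_fraction =
  fixes p n :: nat
    and S :: "nat \<Rightarrow> nat \<Rightarrow> complex fls"
    and P Q :: "nat \<Rightarrow> nat \<Rightarrow> complex poly"
  assumes n_pos: "n \<ge> 1"
    and fraction: "a < p \<Longrightarrow> c < p \<Longrightarrow>
      (\<Sum>b<p. S a b * poly_at_infinity (P b c)) = poly_at_infinity (Q a c)"
    and hermitian: "a < p \<Longrightarrow> b < p \<Longrightarrow> fls_nth (S b a) i = cnj (fls_nth (S a b) i)"
    and degree_P: "b < p \<Longrightarrow> c < p \<Longrightarrow> degree (P b c) \<le> n"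
    and monic_P: "b < p \<Longrightarrow> c < p \<Longrightarrow> coeff (P b c) n = (if b = c then 1 else 0)"
    and degree_Q: "a < p \<Longrightarrow> c < p \<Longrightarrow> degree (Q a c) \<le> n + 1"
    and hankel_neg: "(\<And>b. b < p \<Longrightarrow> degree (u b) < n) \<Longrightarrow> b < p \<Longrightarrow> u b \<noteq> 0 \<Longrightarrow>
      Re (hankel_form p S u u) < 0"
    and leading_nonneg: "Re (\<Sum>a<p. \<Sum>b<p. cnj (x a) * (fls_nth (S a b) (- 1) * x b)) \<ge> 0"
begin

abbreviation form where "form \<equiv> hankel_form p S"

text \<open>By \<open>hermitian\<close>, conjugating a coefficient transposes its entry, while
  conjugating the polynomial factor exchanges the roles of \<open>u\<close> and
  \<open>v\<close>.\<close>

lemma form_commute: "form v u = cnj (form u v)"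
proof -
  have *: "fls_nth (S b a * poly_at_infinity (cnj_poly (u b) * v a)) 1
      = cnj (fls_nth (S a b * poly_at_infinity (cnj_poly (v a) * u b)) 1)"
    if "a < p" "b < p" for a b
  proof -
    have eq: "cnj_poly (u b) * v a = cnj_poly (cnj_poly (v a) * u b)"
      by (simp add: cnj_poly_mult mult.commute)
    have deg: "degree (cnj_poly (cnj_poly (v a) * u b)) \<le> degree (cnj_poly (v a) * u b)"
      by (rule map_poly_degree_leq)
    show ?thesis
      unfolding eq fls_nth_times_poly_at_infinity[OF deg]
        fls_nth_times_poly_at_infinity[OF order_refl[of "degree (cnj_poly (v a) * u b)"]]
      by (simp add: coeff_cnj_poly hermitian[OF that])
  qed
  have "form v u = (\<Sum>b<p. \<Sum>a<p. cnj (fls_nth (S a b * poly_at_infinity (cnj_poly (v a) * u b)) 1))"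
    unfolding hankel_form_def by (intro sum.cong refl) (simp add: *)
  also have "\<dots> = cnj (form u v)"
    unfolding hankel_form_def by (subst sum.swap) simp
  finally show ?thesis .
qed

lemma fraction_combination:
  assumes "a < p"
  shows "(\<Sum>b<p. S a b * poly_at_infinity (\<Sum>c<p. P b c * y c))
    = poly_at_infinity (\<Sum>c<p. Q a c * y c)"
proof -
  have "(\<Sum>b<p. S a b * poly_at_infinity (\<Sum>c<p. P b c * y c))
      = (\<Sum>b<p. \<Sum>c<p. S a b * poly_at_infinity (P b c) * poly_at_infinity (y c))"
    by (simp add: poly_at_infinity_sum poly_at_infinity_mult sum_distrib_left mult_ac)
  also have "\<dots> = (\<Sum>c<p. (\<Sum>b<p. S a b * poly_at_infinity (P b c)) * poly_at_infinity (y c))"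
    by (subst sum.swap) (simp add: sum_distrib_right)
  also have "\<dots> = poly_at_infinity (\<Sum>c<p. Q a c * y c)"
    using assms by (simp add: fraction poly_at_infinity_sum poly_at_infinity_mult)
  finally show ?thesis .
qed

lemma form_P_left: "form (\<lambda>b. \<Sum>c<p. P b c * y c) v = 0"
  by (simp add: hankel_form_altdef fraction_combination fls_nth_poly_at_infinity_mult_1)

lemma form_P_right: "form v (\<lambda>b. \<Sum>c<p. P b c * y c) = 0"
  using form_P_left by (metis form_commute complex_cnj_zero)

lemma form_self_real: "Im (form u u) = 0"
  by (rule Im_eq_0_if_cnj_eq, rule form_commute[symmetric])

lemma form_self_eq_0D:
  assumes "\<And>b. b < p \<Longrightarrow> degree (u b) < n" "form u u = 0" "b < p"
  shows "u b = 0"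
  using hankel_neg[of u b] assms by fastforce

section \<open>Null vectors of \<open>P\<close> and quotients of \<open>P x\<close> by linear
  factors\<close>

definition comb :: "(nat \<Rightarrow> nat \<Rightarrow> complex poly) \<Rightarrow> (nat \<Rightarrow> complex) \<Rightarrow> nat \<Rightarrow> complex poly" where
  "comb F x b = (\<Sum>c<p. F b c * [:x c:])"

lemma poly_comb: "poly (comb F x b) z = (\<Sum>c<p. poly (F b c) z * x c)"
  by (simp add: comb_def poly_sum mult.commute)

lemma degree_comb_P: "b < p \<Longrightarrow> degree (comb P x b) \<le> n"
  unfolding comb_def by (intro degree_sum_le) (auto simp: degree_P intro: order_trans[OF degree_smult_le])

lemma coeff_comb_P: 
  assumes "b < p" shows "coeff (comb P x b) n = x b"
proof -
  have "coeff (comb P x b) n = (\<Sum>c<p. if b = c then x c else 0)"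
    unfolding comb_def coeff_sum using assms by (intro sum.cong) (auto simp: monic_P)
  thus ?thesis using assms by simp
qed

text \<open>The vector polynomial \<open>(P x - P(z) x) / (X - z)\<close>, the test vector in the
  results below on zeros, null vectors and the imaginary part.\<close>

definition quot :: "(nat \<Rightarrow> complex) \<Rightarrow> complex \<Rightarrow> nat \<Rightarrow> complex poly" where
  "quot x z b = synthetic_div (comb P x b) z"

lemma quot_correct: "[:- z, 1:] * quot x z b + [:poly (comb P x b) z:] = comb P x b"
  unfolding quot_def by (rule synthetic_div_correct')

lemma degree_quot: "b < p \<Longrightarrow> degree (quot x z b) < n"
  unfolding quot_def degree_synthetic_div using degree_comb_P[of b x] n_pos by linarith

text \<open>A zero quotient makes entry \<open>b\<close> of \<open>P x\<close> constant, whereas its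
  coefficient at \<open>n \<ge> 1\<close> is \<open>x b\<close> because \<open>P\<close> is
  monic.\<close>

lemma quot_eq_0D:
  assumes "b < p" "quot x z b = 0" shows "x b = 0"
proof -
  have "degree (comb P x b) < n"
    using assms(2) n_pos unfolding quot_def synthetic_div_eq_0_iff by simp
  thus ?thesis using coeff_comb_P[OF assms(1), of x] by (simp add: coeff_eq_0)
qed

lemma form_comb_P_left: "form (comb P x) v = 0"
  unfolding comb_def[abs_def] by (rule form_P_left)

lemma form_comb_P_right: "form v (comb P x) = 0"
  unfolding comb_def[abs_def] by (rule form_P_right)

theorem zeros_real:
  assumes zero: "\<And>b. b < p \<Longrightarrow> (\<Sum>c<p. poly (P b c) z * x c) = 0"
    and "b < p" "x b \<noteq> 0"
  shows "z \<in> \<real>"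
proof -
  let ?u = "quot x z"
  have u: "[:- z, 1:] * ?u b = comb P x b" if "b < p" for b
    using quot_correct[of z x b] zero[OF that] by (simp add: poly_comb)
  have "form (\<lambda>b. [:- z, 1:] * ?u b) ?u = form (comb P x) ?u"
    by (intro hankel_form_cong) (simp_all only: u)
  hence zero: "form (\<lambda>b. [:- z, 1:] * ?u b) ?u = 0" by (simp only: form_comb_P_left)
  hence "0 = form (\<lambda>b. [:- z, 1:] * ?u b) ?u" by (rule sym)
  \<comment> \<open>Changing sides replaces \<open>z\<close> by \<open>cnj z\<close> in the factor;
    restoring \<open>z\<close> costs the correction \<open>(z - cnj z) u\<close>. As
    \<open>(X - z) u = P x\<close> contributes nothing, \<open>(z - cnj z) [u, u] = 0\<close>
    remains.\<close>
  also have "\<dots> = form ?u (\<lambda>b. [:- cnj z, 1:] * ?u b)"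
    by (subst hankel_form_mult_left) (simp add: cnj_poly_pCons)
  also have "\<dots> = form ?u (\<lambda>b. [:- z, 1:] * ?u b + Polynomial.smult (z - cnj z) (?u b))"
    by (intro hankel_form_cong) (simp_all add: smult_diff_left)
  also have "\<dots> = cnj (form (\<lambda>b. [:- z, 1:] * ?u b) ?u + (z - cnj z) * form ?u ?u)"
    by (subst form_commute) (simp only: hankel_form_add_left hankel_form_smult_left)
  finally have "z - cnj z = 0 \<or> form ?u ?u = 0" unfolding zero by auto
  moreover have "form ?u ?u \<noteq> 0"
    using form_self_eq_0D[of ?u b] degree_quot quot_eq_0D assms(2,3) by blast
  ultimately show ?thesis by (simp add: Reals_cnj_iff)
qed

theorem no_Jordan_chain:
  assumes x: "\<And>b. b < p \<Longrightarrow> (\<Sum>c<p. poly (P b c) z * x c) = 0"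
    and y: "\<And>b. b < p \<Longrightarrow> (\<Sum>c<p. poly (pderiv (P b c)) z * x c) + (\<Sum>c<p. poly (P b c) z * y c) = 0"
    and "b < p"
  shows "x b = 0"
proof (rule ccontr)
  assume "x b \<noteq> 0"
  hence "z \<in> \<real>" using zeros_real[OF x] \<open>b < p\<close> by blast
  hence cnj_z: "cnj z = z" by (simp add: Reals_cnj_iff)
  let ?u = "quot x z" and ?w = "quot y z"
  have u: "[:- z, 1:] * ?u b = comb P x b" if "b < p" for b
    using quot_correct[of z x b] x[OF that] by (simp add: poly_comb)
  \<comment> \<open>Differentiating \<open>(X - z) u = P x\<close> at \<open>z\<close> gives
    \<open>u(z) = P'(z) x\<close>. The chain equation thus says that \<open>P y + u\<close> vanishes
    at \<open>z\<close>, which makes the quotient \<open>g\<close> exact.\<close>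
  have "poly (?u b) z = (\<Sum>c<p. poly (pderiv (P b c)) z * x c)" if "b < p" for b
  proof -
    have "poly (?u b) z = poly (pderiv ([:- z, 1:] * ?u b)) z"
      by (simp add: pderiv_mult pderiv_pCons del: mult_pCons_left)
    also have "\<dots> = poly (pderiv (comb P x b)) z" using u[OF that] by simp
    also have "\<dots> = (\<Sum>c<p. poly (pderiv (P b c)) z * x c)"
      by (simp add: comb_def pderiv_sum pderiv_smult poly_sum mult.commute)
    finally show ?thesis .
  qed
  hence uy: "poly (?u b) z + poly (comb P y b) z = 0" if "b < p" for b
    using y that by (simp add: poly_comb)
  define g where "g b = synthetic_div (comb P y b + ?u b) z" for b
  have g: "[:- z, 1:] * g b = comb P y b + ?u b" if "b < p" for b
    using synthetic_div_correct'[of z "comb P y b + ?u b"] uy[OF that]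
    unfolding g_def by (simp add: add.commute)
  have "form ?u ?u = form (comb P y) ?u + form ?u ?u" by (simp add: form_comb_P_left)
  also have "\<dots> = form (\<lambda>b. [:- z, 1:] * g b) ?u"
    unfolding hankel_form_add_left[symmetric] using g by (intro hankel_form_cong) simp_all
  also have "\<dots> = form g (\<lambda>b. [:- z, 1:] * ?u b)"
    by (subst hankel_form_mult_left) (simp add: cnj_poly_pCons cnj_z)
  also have "\<dots> = form g (comb P x)" using u by (intro hankel_form_cong) simp_all
  finally have "form ?u ?u = 0" by (simp add: form_comb_P_right)
  hence "?u b = 0" using form_self_eq_0D[of ?u b] degree_quot \<open>b < p\<close> by blast
  thus False using quot_eq_0D \<open>b < p\<close> \<open>x b \<noteq> 0\<close> by blast
qed

theorem no_common_null_vector: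
  assumes x: "\<And>b. b < p \<Longrightarrow> (\<Sum>c<p. poly (P b c) z * x c) = 0"
    and y: "\<And>a. a < p \<Longrightarrow> (\<Sum>c<p. poly (Q a c) z * x c) = 0"
    and "b < p"
  shows "x b = 0"
proof -
  let ?u = "quot x z"
  have u: "[:- z, 1:] * ?u b = comb P x b" if "b < p" for b
    using quot_correct[of z x b] x[OF that] by (simp add: poly_comb)
  \<comment> \<open>\<open>(X - z) R u = R P x = Q x\<close>, and \<open>Q x\<close> vanishes at
    \<open>z\<close>; cancelling the linear factor in the field of Laurent series exhibits
    \<open>R u\<close> as a polynomial.\<close>
  have "(\<Sum>b<p. S a b * poly_at_infinity (?u b)) = poly_at_infinity (synthetic_div (comb Q x a) z)"
    if "a < p" for a
  proof -
    have "poly_at_infinity [:- z, 1:] * (\<Sum>b<p. S a b * poly_at_infinity (?u b))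
        = (\<Sum>b<p. S a b * poly_at_infinity (comb P x b))"
      unfolding sum_distrib_left
      by (intro sum.cong refl) (simp add: poly_at_infinity_mult mult_ac del: mult_pCons_left mult_pCons_right flip: u)
    also have "\<dots> = poly_at_infinity (comb Q x a)"
      unfolding comb_def using fraction_combination[OF that, of "\<lambda>c. [:x c:]"] .
    also have "\<dots> = poly_at_infinity [:- z, 1:] * poly_at_infinity (synthetic_div (comb Q x a) z)"
      unfolding poly_at_infinity_mult[symmetric]
      using synthetic_div_correct'[of z "comb Q x a"] y[OF that] by (simp add: poly_comb)
    finally show ?thesis by simp
  qed
  hence "form ?u ?u = 0" by (simp add: hankel_form_altdef fls_nth_poly_at_infinity_mult_1)
  hence "?u b = 0" using form_self_eq_0D[of ?u b] degree_quot \<open>b < p\<close> by blast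
  thus ?thesis using quot_eq_0D \<open>b < p\<close> by blast
qed

text \<open>As \<open>P\<close> is monic of degree \<open>n\<close>, \<open>R\<close> grows at most
  like \<open>z\<close> to the power \<open>d - n\<close>. The induction climbs from a common lower
  bound \<open>m\<close> of the subdegrees. With \<open>d = n + 1\<close> it kills everything above
  the power \<open>z\<close>; with \<open>d < n - 1\<close> it kills s_0.\<close>

lemma S_nth_eq_0:
  assumes d: "\<And>a c. a < p \<Longrightarrow> c < p \<Longrightarrow> degree (Q a c) \<le> d"
    and "i < int n - int d" "a < p" "c < p"
  shows "fls_nth (S a c) i = 0"
proof -
  define m where "m = Min (insert 0 ((\<lambda>(a, b). fls_subdegree (S a b)) ` ({..<p} \<times> {..<p})))"
  have m: "fls_nth (S a b) i = 0" if "a < p" "b < p" "i < m" for a b i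
  proof (rule fls_eq0_below_subdegree)
    have "m \<le> fls_subdegree (S a b)"
      unfolding m_def using that by (intro Min_le) auto
    thus "i < fls_subdegree (S a b)" using that by simp
  qed
  have "\<forall>a<p. \<forall>c<p. \<forall>i<m + int N. fls_nth (S a c) i = 0" if "m + int N \<le> int n - int d" for N
    using that
  proof (induction N)
    case (Suc N)
    have "fls_nth (S a c) i = 0" if a: "a < p" and c: "c < p" and i: "i = m + int N" for a c i
    proof -
      \<comment> \<open>All coefficients of \<open>S\<close> below \<open>i\<close> vanish already,
        so at index \<open>i - n\<close> only the leading coefficient of \<open>P\<close>, the
        identity, contributes.\<close>
      have "fls_nth (S a b * poly_at_infinity (P b c)) (i - int n) = (if b = c then fls_nth (S a c) i else 0)"
        if "b < p" for b
      proof -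
        have "fls_nth (S a b * poly_at_infinity (P b c)) (i - int n)
            = (\<Sum>k\<le>n. coeff (P b c) k * fls_nth (S a b) (i - int n + int k))"
          using degree_P[OF that c] by (rule fls_nth_times_poly_at_infinity)
        also have "\<dots> = (\<Sum>k\<in>{n}. coeff (P b c) k * fls_nth (S a b) (i - int n + int k))"
          using Suc a that i by (intro sum.mono_neutral_right) auto
        finally show ?thesis using monic_P[OF that c] by simp
      qed
      hence "fls_nth (\<Sum>b<p. S a b * poly_at_infinity (P b c)) (i - int n) = fls_nth (S a c) i"
        using c by (simp add: fls_nth_sum)
      moreover have "fls_nth (poly_at_infinity (Q a c)) (i - int n) = 0"
        using d[OF a c] Suc.prems i
        by (auto simp: fls_nth_poly_at_infinity intro!: coeff_eq_0)
      ultimately show ?thesis using fraction[OF a c] by simp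
    qed
    moreover have "\<forall>a<p. \<forall>c<p. \<forall>i<m + int N. fls_nth (S a c) i = 0"
      using Suc by simp
    moreover have "i = m + int N \<or> i < m + int N" if "i < m + int (Suc N)" for i
      using that by linarith
    ultimately show ?case by blast
  qed (use m in simp)
  from this[of "nat (int n - int d - m)"] show ?thesis
    using assms(2-4) m[of a c i] by (cases "m \<le> int n - int d") auto
qed

text \<open>For \<open>v = P(z) x\<close> one has \<open>R(z) v = Q(z) x\<close>, so the sum is
  \<open>v^* R(z) v\<close> written without an inverse.\<close>

theorem Im_nonneg:
  fixes x :: "nat \<Rightarrow> complex"
  assumes "Im z > 0"
  defines "v \<equiv> \<lambda>b. \<Sum>c<p. poly (P b c) z * x c"
  shows "Im (\<Sum>a<p. cnj (v a) * (\<Sum>c<p. poly (Q a c) z * x c)) \<ge> 0"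
proof -
  let ?u = "quot x z" and ?L = "poly_at_infinity [:- z, 1:]"
  have v: "v b = poly (comb P x b) z" for b by (simp add: v_def poly_comb)
  have u: "[:- z, 1:] * ?u b + [:v b:] = comb P x b" for b
    unfolding v by (rule quot_correct)
  \<comment> \<open>\<open>X\<close> expands \<open>(R(z) v - R v) / (X - z)\<close> at infinity,
    with \<open>R(z) v\<close> standing for \<open>Q(z) x\<close>. It differs from
    \<open>R u\<close> by a polynomial only, so both have the same coefficient at \<open>1\<close>,
    the one entering \<open>[u, v]\<close>.\<close>
  define X where "X a = (\<Sum>b<p. S a b * poly_at_infinity (?u b)) 
      - poly_at_infinity (synthetic_div (comb Q x a) z)" for a
  have LX: "?L * X a = fls_const (poly (comb Q x a) z) - (\<Sum>b<p. S a b * fls_const (v b))"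
    if "a < p" for a
  proof -
    have "?L * X a = (\<Sum>b<p. S a b * poly_at_infinity ([:- z, 1:] * ?u b))
        - poly_at_infinity ([:- z, 1:] * synthetic_div (comb Q x a) z)"
      unfolding X_def by (simp only: poly_at_infinity_mult algebra_simps sum_distrib_left)
    also have "(\<Sum>b<p. S a b * poly_at_infinity ([:- z, 1:] * ?u b))
        = (\<Sum>b<p. S a b * poly_at_infinity (comb P x b)) - (\<Sum>b<p. S a b * fls_const (v b))"
      unfolding u[symmetric] poly_at_infinity_add poly_at_infinity_const
      by (simp only: algebra_simps sum.distrib)
    also have "(\<Sum>b<p. S a b * poly_at_infinity (comb P x b)) = poly_at_infinity (comb Q x a)"
      unfolding comb_def using fraction_combination[OF that, of "\<lambda>c. [:x c:]"] .
    also have "\<dots> = poly_at_infinity ([:- z, 1:] * synthetic_div (comb Q x a) z) 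
        + fls_const (poly (comb Q x a) z)"
      by (metis poly_at_infinity_add poly_at_infinity_const synthetic_div_correct')
    finally show ?thesis by simp
  qed
  have L: "fls_nth (?L * F) i = fls_nth F (i + 1) - z * fls_nth F i" for F i
  proof -
    have "?L * F = fls_X_inv * F - fls_const z * F"
      by (simp add: poly_at_infinity_pCons algebra_simps)
    thus ?thesis by (simp add: fls_nth_X_inv_times)
  qed
  have rec: "fls_nth (X a) (i + 1) = z * fls_nth (X a) i + (if i = 0 then poly (comb Q x a) z else 0)
      - (\<Sum>b<p. fls_nth (S a b) i * v b)" if "a < p" for a i
    using arg_cong[OF LX[OF that], of "\<lambda>F. fls_nth F i"] unfolding L
    by (auto simp: fls_nth_sum algebra_simps)
  \<comment> \<open>\<open>S\<close> has no coefficients below \<open>- 1\<close>, so there the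
    recursion is multiplication by \<open>z\<close>. A nonzero coefficient at \<open>- 1\<close>
    would make all earlier ones nonzero, impossible for a Laurent series.\<close>
  have X0: "fls_nth (X a) (- 1) = 0" if "a < p" for a
  proof (rule ccontr)
    assume *: "fls_nth (X a) (- 1) \<noteq> 0"
    have "fls_nth (X a) (- 1 - int k) \<noteq> 0" for k
    proof (induction k)
      case (Suc k)
      thus ?case using rec[OF that, of "- 2 - int k"] S_nth_eq_0[OF degree_Q _ that] by auto
    qed (use * in simp)
    hence "fls_nth (X a) (- 1 - int (nat (- fls_subdegree (X a)))) \<noteq> 0" by blast
    moreover have "- 1 - int (nat (- fls_subdegree (X a))) < fls_subdegree (X a)" by linarith
    ultimately show False using fls_eq0_below_subdegree by blast
  qed
  \<comment> \<open>Two steps of the recursion from the vanishing coefficient at \<open>- 1\<close>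
    pick up s_{-2} and s_{-1}.\<close>
  have X1: "fls_nth (X a) 1 = poly (comb Q x a) z 
      - (\<Sum>b<p. fls_nth (S a b) 0 * v b) - z * (\<Sum>b<p. fls_nth (S a b) (- 1) * v b)"
    if "a < p" for a
    using rec[OF that, of "-1"] rec[OF that, of 0] X0[OF that] by (simp add: algebra_simps)
  have "form ?u (\<lambda>a. [:v a:]) = (\<Sum>a<p. cnj (v a) * fls_nth (X a) 1)"
    unfolding hankel_form_altdef X_def
    by (intro sum.cong refl)
       (simp add: cnj_poly_pCons poly_at_infinity_const fls_nth_poly_at_infinity)
  also have "\<dots> = (\<Sum>a<p. cnj (v a) * poly (comb Q x a) z)
      - (\<Sum>a<p. \<Sum>b<p. cnj (v a) * (fls_nth (S a b) 0 * v b))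
      - z * (\<Sum>a<p. \<Sum>b<p. cnj (v a) * (fls_nth (S a b) (- 1) * v b))"
    by (simp add: X1 algebra_simps sum_subtractf sum_distrib_left sum.distrib)
  finally have val: "(\<Sum>a<p. cnj (v a) * poly (comb Q x a) z) = form ?u (\<lambda>a. [:v a:])
      + (\<Sum>a<p. \<Sum>b<p. cnj (v a) * (fls_nth (S a b) 0 * v b))
      + z * (\<Sum>a<p. \<Sum>b<p. cnj (v a) * (fls_nth (S a b) (- 1) * v b))"
    by simp
  have real: "Im (\<Sum>a<p. \<Sum>b<p. cnj (v a) * (fls_nth (S a b) i * v b)) = 0" for i
  proof -
    have "cnj (\<Sum>a<p. \<Sum>b<p. cnj (v a) * (fls_nth (S a b) i * v b))
        = (\<Sum>a<p. \<Sum>b<p. cnj (v b) * (fls_nth (S b a) i * v a))"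
      unfolding cnj_sum by (intro sum.cong refl) (simp flip: hermitian)
    also have "\<dots> = (\<Sum>a<p. \<Sum>b<p. cnj (v a) * (fls_nth (S a b) i * v b))"
      by (rule sum.swap)
    finally show ?thesis by (rule Im_eq_0_if_cnj_eq)
  qed
  have "form (\<lambda>b. [:0, 1:] * ?u b) ?u = form ?u (\<lambda>b. [:0, 1:] * ?u b)"
    by (subst hankel_form_mult_left) (simp add: cnj_poly_pCons)
  also have "\<dots> = cnj (form (\<lambda>b. [:0, 1:] * ?u b) ?u)" by (rule form_commute)
  finally have real': "Im (form (\<lambda>b. [:0, 1:] * ?u b) ?u) = 0"
    by (rule Im_eq_0_if_cnj_eq[OF sym])
  \<comment> \<open>Expand \<open>P x = X u - z u + v\<close> on the left. Since
    \<open>[X u, u]\<close> and \<open>[u, u]\<close> are real, the imaginary part of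
    \<open>[v, u]\<close> must balance that of \<open>z [u, u]\<close>.\<close>
  have "0 = form (comb P x) ?u" by (simp add: form_comb_P_left)
  also have "\<dots> = form (\<lambda>b. ([:0, 1:] * ?u b + Polynomial.smult (- z) (?u b)) + [:v b:]) ?u"
    by (intro hankel_form_cong) (simp_all flip: u)
  also have "\<dots> = form (\<lambda>b. [:0, 1:] * ?u b) ?u - z * form ?u ?u + form (\<lambda>b. [:v b:]) ?u"
    unfolding hankel_form_add_left hankel_form_smult_left by simp
  finally have "Im (form (\<lambda>b. [:v b:]) ?u) = Im z * Re (form ?u ?u)"
    using real' form_self_real[of ?u] by (simp add: complex_eq_iff)
  hence "Im (form ?u (\<lambda>a. [:v a:])) = - Im z * Re (form ?u ?u)"
    by (subst form_commute) simp
  moreover have "Re (form ?u ?u) \<le> 0"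
    using hankel_neg[of ?u] degree_quot[of _ x z] form_self_real
    by (cases "\<exists>b<p. ?u b \<noteq> 0") (force, simp add: hankel_form_def)
  ultimately have "Im (form ?u (\<lambda>a. [:v a:])) \<ge> 0"
    using assms(1) by (simp add: mult_nonneg_nonpos)
  thus ?thesis
    using val real leading_nonneg[of v] assms(1) by (simp add: poly_comb)
qed

end

section \<open>Monic matrix polynomials and Laurent coefficients of rational functions\<close>

lemma degree_le_mpoly_degree:
  assumes "i < dim_row F" "j < dim_col F"
  shows "degree (F $$ (i, j)) \<le> mpoly_degree F"
proof -
  let ?zero = "\<lambda>d. \<forall>k>d. mpoly_coeff F k = 0\<^sub>m (dim_row F) (dim_col F)"
  \<comment> \<open>The largest entry degree witnesses that the \<open>LEAST\<close> in
    \<open>mpoly_degree\<close> is taken over a nonempty set; the inserted \<open>0\<close> covers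
    matrices without entries.\<close>
  define d where "d = Max (insert 0 ((\<lambda>(i, j). degree (F $$ (i, j))) ` ({..<dim_row F} \<times> {..<dim_col F})))"
  have "degree (F $$ (i, j)) \<le> d" if "i < dim_row F" "j < dim_col F" for i j
    unfolding d_def using that by (intro Max_ge) auto
  hence "?zero d"
    by (auto simp: mpoly_coeff_def intro!: eq_matI coeff_eq_0) (meson le_less_trans)
  hence "?zero (mpoly_degree F)" unfolding mpoly_degree_def by (rule LeastI)
  hence "mpoly_coeff F k $$ (i, j) = 0" if "k > mpoly_degree F" for k
    using assms that by simp
  thus ?thesis using assms by (intro degree_le) (simp add: mpoly_coeff_def)
qed

lemma coeff_monic:
  assumes "mpoly_monic F" "F \<in> carrier_mat p p" "i < p" "j < p"
  shows "coeff (F $$ (i, j)) (mpoly_degree F) = (if i = j then 1 else 0)"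
proof -
  have "mpoly_coeff F (mpoly_degree F) $$ (i, j) = 1\<^sub>m p $$ (i, j)"
    using assms unfolding mpoly_monic_def by simp
  thus ?thesis using assms by (simp add: mpoly_coeff_def)
qed

text \<open>A singular \<open>F\<close> has a nonzero polynomial null vector \<open>v\<close>. If
  \<open>m\<close> is the largest degree of its entries, the coefficient of \<open>F v\<close> at
  \<open>mpoly_degree F + m\<close> is that of \<open>v\<close> at \<open>m\<close> by monicity,
  hence nonzero in some entry.\<close>

lemma det_monic_nonzero:
  assumes monic: "mpoly_monic F" and F: "F \<in> carrier_mat p p"
  shows "det F \<noteq> 0"
proof
  assume "det F = 0"
  then obtain v where v: "v \<in> carrier_vec p" "v \<noteq> 0\<^sub>v p" and Fv: "F *\<^sub>v v = 0\<^sub>v p"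
    using det_0_iff_vec_prod_zero[OF F] by blast
  let ?n = "mpoly_degree F"
  obtain c0 where c0: "c0 < p" "v $ c0 \<noteq> 0" using v by (metis carrier_vecD eq_vecI index_zero_vec)
  define m where "m = Max ((\<lambda>c. degree (v $ c)) ` {c. c < p \<and> v $ c \<noteq> 0})"
  have "m \<in> (\<lambda>c. degree (v $ c)) ` {c. c < p \<and> v $ c \<noteq> 0}"
    unfolding m_def using c0 by (intro Max_in) auto
  then obtain a where a: "a < p" "v $ a \<noteq> 0" "degree (v $ a) = m" by auto
  have m: "degree (v $ c) \<le> m" if "c < p" for c
    unfolding m_def using that c0 by (cases "v $ c = 0") (auto intro!: Max_ge)
  have top: "coeff (F $$ (a, c) * v $ c) (?n + m) = (if a = c then coeff (v $ c) m else 0)"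
    if "c < p" for c
  proof -
    have "degree (F $$ (a, c)) \<le> ?n" using F a that by (intro degree_le_mpoly_degree) auto
    hence "coeff (F $$ (a, c) * v $ c) (?n + m) = coeff (F $$ (a, c)) ?n * coeff (v $ c) m"
    proof -
      assume d: "degree (F $$ (a, c)) \<le> ?n"
      have "coeff (F $$ (a, c) * v $ c) (?n + m)
          = (\<Sum>i\<le>?n + m. coeff (F $$ (a, c)) i * coeff (v $ c) (?n + m - i))"
        by (rule coeff_mult)
      also have "\<dots> = (\<Sum>i\<in>{?n}. coeff (F $$ (a, c)) i * coeff (v $ c) (?n + m - i))"
      proof (rule sum.mono_neutral_right)
        show "\<forall>i\<in>{..?n + m} - {?n}. coeff (F $$ (a, c)) i * coeff (v $ c) (?n + m - i) = 0"
        proof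
          fix i assume "i \<in> {..?n + m} - {?n}"
          hence "i > ?n \<or> ?n + m - i > m" by auto
          thus "coeff (F $$ (a, c)) i * coeff (v $ c) (?n + m - i) = 0"
            using d m[OF that] by (auto intro!: coeff_eq_0)
        qed
      qed auto
      finally show ?thesis by simp
    qed
    thus ?thesis using coeff_monic[OF monic F a(1) that] by simp
  qed
  have "(F *\<^sub>v v) $ a = (\<Sum>c<p. F $$ (a, c) * v $ c)"
    using F v a by (simp add: scalar_prod_def lessThan_atLeast0)
  hence "0 = coeff (\<Sum>c<p. F $$ (a, c) * v $ c) (?n + m)" using Fv a by simp
  also have "\<dots> = (\<Sum>c<p. if a = c then coeff (v $ c) m else 0)"
    by (simp add: coeff_sum top)
  also have "\<dots> = lead_coeff (v $ a)" using a by simp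
  finally show False using a(2) by simp
qed

lemma mat_inverse_det_nonzero:
  fixes A :: "'a :: field mat"
  assumes A: "A \<in> carrier_mat n n" and "det A \<noteq> 0"
  shows "A * the (mat_inverse A) = 1\<^sub>m n" "the (mat_inverse A) * A = 1\<^sub>m n"
    "the (mat_inverse A) \<in> carrier_mat n n"
proof -
  obtain B where "mat_inverse A = Some B"
    using mat_inverse(1)[OF A] det_non_zero_imp_unit[OF assms] by fastforce
  thus "A * the (mat_inverse A) = 1\<^sub>m n" "the (mat_inverse A) * A = 1\<^sub>m n"
    "the (mat_inverse A) \<in> carrier_mat n n"
    using mat_inverse(2)[OF A] by auto
qed

lemma fls_cnj_exists: "\<exists>G. \<forall>i. fls_nth G i = cnj (fls_nth F i)"
proof
  show "\<forall>i. fls_nth (Abs_fls (\<lambda>i. cnj (fls_nth F i))) i = cnj (fls_nth F i)"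
    by (intro allI nth_Abs_fls_lower_bound[of "fls_subdegree F"]) simp
qed

text \<open>Conjugating the coefficients of \<open>g / d\<close> gives
  \<open>cnj_poly g / cnj_poly d\<close>, which the hypothesis identifies with \<open>f / d\<close>
  by cross-multiplication.\<close>

lemma fls_quotient_cnj:
  assumes "f * cnj_poly d = cnj_poly g * d" "d \<noteq> 0"
  shows "fls_nth (poly_at_infinity f / poly_at_infinity d) i
    = cnj (fls_nth (poly_at_infinity g / poly_at_infinity d) i)"
proof -
  define F where "F = poly_at_infinity g / poly_at_infinity d"
  obtain G where G: "\<And>i. fls_nth G i = cnj (fls_nth F i)" using fls_cnj_exists by blast
  have "G * poly_at_infinity (cnj_poly d) = poly_at_infinity (cnj_poly g)"
  proof (rule fls_eqI)
    fix i
    have "fls_nth (G * poly_at_infinity (cnj_poly d)) i = cnj (fls_nth (F * poly_at_infinity d) i)"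
      unfolding fls_nth_times_poly_at_infinity[OF map_poly_degree_leq]
        fls_nth_times_poly_at_infinity[OF order_refl[of "degree d"]]
      by (simp add: G coeff_cnj_poly)
    also have "F * poly_at_infinity d = poly_at_infinity g" using assms(2) by (simp add: F_def)
    finally show "fls_nth (G * poly_at_infinity (cnj_poly d)) i = fls_nth (poly_at_infinity (cnj_poly g)) i"
      by (simp add: fls_nth_poly_at_infinity coeff_cnj_poly)
  qed
  hence "G * poly_at_infinity d * poly_at_infinity (cnj_poly d) = poly_at_infinity f * poly_at_infinity (cnj_poly d)"
    using arg_cong[OF assms(1), of poly_at_infinity] by (simp add: poly_at_infinity_mult mult_ac)
  hence "G = poly_at_infinity f / poly_at_infinity d" using assms(2) by (simp add: field_simps)
  thus ?thesis using G by (simp add: F_def)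
qed

text \<open>The series enters only through the index \<open>j + k\<close>, which is the Hankel
  pattern of the Gram matrix.\<close>

lemma fls_nth_times_poly_at_infinity_mult:
  assumes "degree f < n" "degree g < n"
  shows "fls_nth (F * poly_at_infinity (f * g)) i
    = (\<Sum>j<n. \<Sum>k<n. coeff f j * coeff g k * fls_nth F (i + int j + int k))"
proof -
  have n: "{..<n} = {..n - 1}" using assms by auto
  have deg: "degree f \<le> n - 1" "degree g \<le> n - 1" using assms by auto
  have eq: "F * poly_at_infinity (f * g) = F * poly_at_infinity g * poly_at_infinity f"
    by (simp add: poly_at_infinity_mult mult_ac)
  show ?thesis
    unfolding n eq fls_nth_times_poly_at_infinity[OF deg(1)] fls_nth_times_poly_at_infinity[OF deg(2)]
    by (simp add: sum_distrib_left mult.assoc)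
qed

lemma sum_div_mod:
  "(\<Sum>i<n * p. f (i div p) (i mod p)) = (\<Sum>j<n. \<Sum>a<p. f j a)" for p :: nat
proof (cases "p = 0")
  case False
  have "(\<Sum>i<n * p. f (i div p) (i mod p)) = (\<Sum>j<n. \<Sum>i = j * p..<j * p + p. f (i div p) (i mod p))"
    by (rule sum.nat_group[symmetric])
  also have "\<dots> = (\<Sum>j<n. \<Sum>a<p. f j a)"
  proof (rule sum.cong[OF refl])
    fix j
    show "(\<Sum>i = j * p..<j * p + p. f (i div p) (i mod p)) = (\<Sum>a<p. f j a)"
      using sum.shift_bounds_nat_ivl[of "\<lambda>i. f (i div p) (i mod p)" 0 "j * p" p] False
      by (simp add: lessThan_atLeast0 add.commute)
  qed
  finally show ?thesis .
qed simp

lemma mat_adjoint_carrier: "A \<in> carrier_mat m n \<Longrightarrow> mat_adjoint A \<in> carrier_mat n m"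
  unfolding mat_adjoint_def by auto

lemma mat_adjoint_index:
  assumes "A \<in> carrier_mat m n" "i < n" "j < m"
  shows "mat_adjoint A $$ (i, j) = conjugate (A $$ (j, i))"
  using assms unfolding mat_adjoint_def by (simp add: mat_of_rows_index)

section \<open>The rational matrix function\<close>

lemma diff_cnj_divide_2i: "(w - cnj w) / (2 * \<i>) = of_real (Im w)"
  by (simp add: complex_eq_iff)

locale matrix_fraction =
  fixes p :: nat
    and R :: "complex \<Rightarrow> complex mat"
    and Q P :: "complex poly mat"
  assumes self_adjoint: "self_adjoint_mat_function p R"
    and Q: "Q \<in> carrier_mat p p"
    and P: "P \<in> carrier_mat p p"
    and monic: "mpoly_monic P"
    and degree_pos: "mpoly_degree P \<ge> 1"
    and R_eq: "\<forall>z. z \<notin> mpoly_zeros P \<longrightarrow>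
           R z = mpoly_eval Q z * the (mat_inverse (mpoly_eval P z))"
    and H_nonneg: "nonneg_def_mat (block_hankel p R (- 2) 0)"
    and H_neg: "neg_def_mat (block_hankel p R 0 (mpoly_degree P - 1))"
    and degree_diff: "int (mpoly_degree Q) - int (mpoly_degree P) \<le> 1"
begin

abbreviation "n \<equiv> mpoly_degree P"

section \<open>Entries of \<open>R\<close> over the common denominator \<open>det P\<close>, and
  their expansions\<close>

definition d where "d = det P"
text \<open>By Cramer's rule \<open>P\<close> has inverse \<open>adj_mat P / d\<close>, so
  \<open>N\<close> is the numerator of \<open>R\<close>.\<close>

definition N where "N = Q * adj_mat P"
definition S where "S a b = laurent_expansion (\<lambda>w. R (1 / w) $$ (a, b)) 0"

lemma d_nonzero: "d \<noteq> 0"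
  unfolding d_def using monic P by (rule det_monic_nonzero)

lemma poly_d: "poly d z = det (mpoly_eval P z)"
  by (simp add: d_def det_mpoly_eval)

lemma R_times_P:
  assumes "poly d z \<noteq> 0"
  shows "R z * mpoly_eval P z = mpoly_eval Q z" "R z \<in> carrier_mat p p"
proof -
  let ?A = "mpoly_eval P z" and ?B = "the (mat_inverse (mpoly_eval P z))"
  have A: "?A \<in> carrier_mat p p" using P by simp
  note B = mat_inverse_det_nonzero[OF A assms[unfolded poly_d]]
  have R: "R z = mpoly_eval Q z * ?B"
    using R_eq assms by (simp add: mpoly_zeros_def poly_d)
  show "R z \<in> carrier_mat p p"
    unfolding R by (rule mult_carrier_mat[OF mpoly_eval_carrier[OF Q] B(3)])
  have "R z * ?A = mpoly_eval Q z * (?B * ?A)"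
    unfolding R by (rule assoc_mult_mat[OF mpoly_eval_carrier[OF Q] B(3) A])
  thus "R z * ?A = mpoly_eval Q z"
    unfolding B(2) right_mult_one_mat[OF mpoly_eval_carrier[OF Q]] .
qed

lemma R_entry:
  assumes z: "poly d z \<noteq> 0" and ab: "a < p" "b < p"
  shows "R z $$ (a, b) = poly (N $$ (a, b)) z / poly d z"
proof -
  let ?A = "mpoly_eval P z"
  have adjP: "adj_mat P \<in> carrier_mat p p" using P by (rule adj_mat)
  have "mpoly_eval N z = mpoly_eval Q z * mpoly_eval (adj_mat P) z"
    unfolding N_def using Q adjP by (rule mpoly_eval_mult)
  also have "mpoly_eval Q z = R z * ?A" using R_times_P[OF z] by simp
  also have "R z * ?A * mpoly_eval (adj_mat P) z = R z * (?A * mpoly_eval (adj_mat P) z)"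
    by (rule assoc_mult_mat[OF R_times_P(2)[OF z] mpoly_eval_carrier[OF P] mpoly_eval_carrier[OF adjP]])
  also have "?A * mpoly_eval (adj_mat P) z = mpoly_eval (d \<cdot>\<^sub>m 1\<^sub>m p) z"
    using mpoly_eval_mult[OF P adjP] adj_mat(2)[OF P] by (simp add: d_def)
  also have "\<dots> = poly d z \<cdot>\<^sub>m 1\<^sub>m p"
    by (auto simp: mpoly_eval_def)
  also have "R z * \<dots> = poly d z \<cdot>\<^sub>m R z"
    using mult_smult_distrib[OF R_times_P(2)[OF z] one_carrier_mat] R_times_P(2)[OF z] by simp
  finally have "mpoly_eval N z $$ (a, b) = poly d z * R z $$ (a, b)"
    using ab R_times_P(2)[OF z] by simp
  moreover have "N \<in> carrier_mat p p" unfolding N_def using Q adjP by simp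
  ultimately show ?thesis using z ab by (simp add: mpoly_eval_def field_simps)
qed

text \<open>Near \<open>w = 0\<close> the denominator \<open>d(1 / w)\<close> has no zeros, so the
  analytic expansion agrees with the quotient formed in the field of formal series.\<close>

lemma S_eq:
  assumes "a < p" "b < p"
  shows "S a b = poly_at_infinity (N $$ (a, b)) / poly_at_infinity d"
proof -
  have "eventually (\<lambda>w. poly d (1 / w) \<noteq> 0) (at 0)"
    using has_laurent_expansion_nonzero_imp_eventually_nonzero[OF
        has_laurent_expansion_poly_at_infinity[of d]] d_nonzero by simp
  hence ev: "eventually (\<lambda>w. poly (N $$ (a, b)) (1 / w) / poly d (1 / w) = R (1 / w) $$ (a, b)) (at 0)"
    by eventually_elim (simp add: R_entry assms)
  have "(\<lambda>w. R (1 / w) $$ (a, b)) has_laurent_expansion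
      poly_at_infinity (N $$ (a, b)) / poly_at_infinity d"
    using has_laurent_expansion_divide[OF has_laurent_expansion_poly_at_infinity[of "N $$ (a, b)"]
        has_laurent_expansion_poly_at_infinity[of d]] has_laurent_expansion_cong[OF ev refl]
    by blast
  thus ?thesis unfolding S_def by (rule laurent_expansion_0_eqI)
qed

lemma S_fraction:
  assumes "a < p" "c < p"
  shows "(\<Sum>b<p. S a b * poly_at_infinity (P $$ (b, c))) = poly_at_infinity (Q $$ (a, c))"
proof -
  have adjP: "adj_mat P \<in> carrier_mat p p" using P by (rule adj_mat)
  have "N * P = Q * (adj_mat P * P)"
    unfolding N_def using Q adjP P by (rule assoc_mult_mat)
  also have "\<dots> = d \<cdot>\<^sub>m Q"
    unfolding adj_mat(3)[OF P] d_def
    using mult_smult_distrib[OF Q one_carrier_mat] Q by simp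
  finally have "(N * P) $$ (a, c) = d * Q $$ (a, c)" using assms Q by simp
  moreover have "N \<in> carrier_mat p p" unfolding N_def using Q adjP by simp
  ultimately have "(\<Sum>b<p. N $$ (a, b) * P $$ (b, c)) = d * Q $$ (a, c)"
    using assms P by (simp add: scalar_prod_def lessThan_atLeast0)
  hence "(\<Sum>b<p. poly_at_infinity (N $$ (a, b)) * poly_at_infinity (P $$ (b, c)))
      = poly_at_infinity d * poly_at_infinity (Q $$ (a, c))"
    by (simp flip: poly_at_infinity_mult poly_at_infinity_sum)
  moreover have "(\<Sum>b<p. S a b * poly_at_infinity (P $$ (b, c)))
      = (\<Sum>b<p. poly_at_infinity (N $$ (a, b)) * poly_at_infinity (P $$ (b, c))) / poly_at_infinity d"
    using assms by (simp add: S_eq sum_divide_distrib)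
  ultimately show ?thesis using d_nonzero by simp
qed

lemma not_pole:
  assumes "poly d z \<noteq> 0"
  shows "z \<notin> mat_poles p R"
proof
  assume "z \<in> mat_poles p R"
  then obtain a b where ab: "a < p" "b < p" and pole: "is_pole (\<lambda>w. R w $$ (a, b)) z"
    by (auto simp: mat_poles_def)
  let ?U = "{w. poly d w \<noteq> 0}"
  have "open ?U" by (intro open_Collect_neq continuous_intros)
  moreover have "(\<lambda>w. R w $$ (a, b)) holomorphic_on ?U"
  proof (rule holomorphic_transform)
    show "(\<lambda>w. poly (N $$ (a, b)) w / poly d w) holomorphic_on ?U"
      by (intro holomorphic_intros) auto
  qed (use ab R_entry in auto)
  ultimately show False using not_is_pole_holomorphic[of ?U z] assms pole by blast
qed

lemma N_conjugate:
  assumes ab: "a < p" "b < p"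
  shows "N $$ (b, a) * cnj_poly d = cnj_poly (N $$ (a, b)) * d"
proof -
  \<comment> \<open>The extra factor \<open>d * cnj_poly d\<close> makes the product vanish where
    self-adjointness cannot be evaluated; being nonzero, it cancels afterwards.\<close>
  have "(N $$ (b, a) * cnj_poly d - cnj_poly (N $$ (a, b)) * d) * (d * cnj_poly d) = 0"
    unfolding poly_all_0_iff_0[symmetric]
  proof
    fix z
    show "poly ((N $$ (b, a) * cnj_poly d - cnj_poly (N $$ (a, b)) * d) * (d * cnj_poly d)) z = 0"
    proof (cases "poly d z = 0 \<or> poly d (cnj z) = 0")
      case False
      hence z: "poly d z \<noteq> 0" "poly d (cnj z) \<noteq> 0" by auto
      have "R z = mat_adjoint (R (cnj z))"
        using self_adjoint not_pole[OF z(1)] not_pole[OF z(2)]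
        unfolding self_adjoint_mat_function_def by blast
      hence "R z $$ (b, a) = cnj (R (cnj z) $$ (a, b))"
        using mat_adjoint_index[OF R_times_P(2)[OF z(2)] ab(2,1)] by simp
      hence "poly (N $$ (b, a)) z / poly d z
          = cnj (poly (N $$ (a, b)) (cnj z)) / cnj (poly d (cnj z))"
        using ab z by (simp add: R_entry)
      thus ?thesis using z by (simp add: poly_cnj_poly field_simps)
    qed (auto simp: poly_cnj_poly)
  qed
  thus ?thesis using d_nonzero by simp
qed

lemma laurent_mat_index: "a < p \<Longrightarrow> b < p \<Longrightarrow> laurent_mat p R j $$ (a, b) = fls_nth (S a b) (j + 1)"
  by (simp add: laurent_mat_def S_def)

text \<open>\<open>v\<close> stacks the coefficient vectors of \<open>u\<close>: position
  \<open>j * p + a\<close> holds the coefficient of \<open>u a\<close> at \<open>j\<close>. The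
  \<open>1\<close> in the index of \<open>S\<close> is the offset between s_j and the exponent of
  \<open>w\<close>.\<close>

lemma block_hankel_form:
  assumes deg: "\<And>b. b < p \<Longrightarrow> degree (u b) < Suc k"
  defines "H \<equiv> block_hankel p R 0 k" and "v \<equiv> vec (Suc k * p) (\<lambda>i. coeff (u (i mod p)) (i div p))"
  shows "(H *\<^sub>v v) \<bullet>c v = hankel_form p S u u"
proof -
  let ?m = "Suc k"
  define g where "g j a l b = cnj (coeff (u a) j) * coeff (u b) l * fls_nth (S a b) (1 + int j + int l)"
    for j a l b
  have idx: "i mod p < p" if "i < ?m * p" for i using that by (cases "p = 0") auto
  have H: "H \<in> carrier_mat (?m * p) (?m * p)" unfolding H_def block_hankel_def by simp
  have Hidx: "H $$ (i, l) = fls_nth (S (i mod p) (l mod p)) (1 + int (i div p) + int (l div p))"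
    if "i < ?m * p" "l < ?m * p" for i l
    using that idx unfolding H_def block_hankel_def by (simp add: laurent_mat_index add_ac)
  have "(H *\<^sub>v v) \<bullet>c v = (\<Sum>i<?m * p. (\<Sum>l<?m * p. H $$ (i, l) * v $ l) * cnj (v $ i))"
    using H by (simp add: scalar_prod_def lessThan_atLeast0 v_def)
  also have "\<dots> = (\<Sum>i<?m * p. \<Sum>l<?m * p. g (i div p) (i mod p) (l div p) (l mod p))"
    unfolding sum_distrib_right
    by (intro sum.cong refl) (simp add: Hidx v_def g_def mult_ac)
  also have "\<dots> = (\<Sum>j<?m. \<Sum>a<p. \<Sum>l<?m * p. g j a (l div p) (l mod p))"
    by (rule sum_div_mod[of "\<lambda>j a. \<Sum>l<?m * p. g j a (l div p) (l mod p)"])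
  also have "\<dots> = (\<Sum>j<?m. \<Sum>a<p. \<Sum>l<?m. \<Sum>b<p. g j a l b)"
    by (intro sum.cong refl sum_div_mod[of "g _ _"])
  also have "\<dots> = (\<Sum>j<?m. \<Sum>a<p. \<Sum>b<p. \<Sum>l<?m. g j a l b)"
    by (intro sum.cong refl sum.swap)
  also have "\<dots> = (\<Sum>a<p. \<Sum>j<?m. \<Sum>b<p. \<Sum>l<?m. g j a l b)"
    by (rule sum.swap)
  also have "\<dots> = (\<Sum>a<p. \<Sum>b<p. \<Sum>j<?m. \<Sum>l<?m. g j a l b)"
    by (intro sum.cong refl sum.swap)
  also have "\<dots> = hankel_form p S u u"
    unfolding hankel_form_def
  proof (intro sum.cong refl)
    fix a b assume "a \<in> {..<p}" "b \<in> {..<p}"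
    hence "degree (cnj_poly (u a)) < ?m" "degree (u b) < ?m"
      using deg le_less_trans[OF map_poly_degree_leq] by auto
    from fls_nth_times_poly_at_infinity_mult[OF this]
    show "(\<Sum>j<?m. \<Sum>l<?m. g j a l b) = fls_nth (S a b * poly_at_infinity (cnj_poly (u a) * u b)) 1"
      by (simp add: coeff_cnj_poly g_def)
  qed
  finally show ?thesis .
qed

lemma S_hankel_neg:
  assumes deg: "\<And>b. b < p \<Longrightarrow> degree (u b) < n" and b: "b < p" "u b \<noteq> 0"
  shows "Re (hankel_form p S u u) < 0"
proof -
  let ?v = "vec (Suc (n - 1) * p) (\<lambda>i. coeff (u (i mod p)) (i div p))"
  have deg': "degree (u b) < Suc (n - 1)" if "b < p" for b using deg[OF that] by simp
  have dim: "dim_row (block_hankel p R 0 (n - 1)) = Suc (n - 1) * p" by (simp add: block_hankel_def)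
  \<comment> \<open>The position of the leading coefficient of \<open>u b\<close> in the stacked
    vector, which shows that this vector is nonzero.\<close>
  let ?i = "degree (u b) * p + b"
  have "?i < Suc (degree (u b)) * p" using b by simp
  also have "\<dots> \<le> Suc (n - 1) * p" using deg'[OF b(1)] by (intro mult_le_mono1) simp
  finally have i: "?i < Suc (n - 1) * p" .
  have "?v $ ?i = lead_coeff (u b)" unfolding index_vec[OF i] using b by simp
  hence "?v \<noteq> 0\<^sub>v (Suc (n - 1) * p)" using b i by (metis index_zero_vec(1) leading_coeff_0_iff)
  moreover have "\<forall>v\<in>carrier_vec (Suc (n - 1) * p). v \<noteq> 0\<^sub>v (Suc (n - 1) * p) \<longrightarrow>
      Re ((block_hankel p R 0 (n - 1) *\<^sub>v v) \<bullet>c v) < 0"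
    using H_neg unfolding neg_def_mat_def dim by blast
  ultimately have "Re ((block_hankel p R 0 (n - 1) *\<^sub>v ?v) \<bullet>c ?v) < 0"
    using vec_carrier by blast
  thus ?thesis using block_hankel_form[of u "n - 1", OF deg'] by simp
qed

lemma S_leading_nonneg:
  "Re (\<Sum>a<p. \<Sum>b<p. cnj (x a) * (fls_nth (S a b) (- 1) * x b)) \<ge> 0"
proof -
  let ?H = "block_hankel p R (- 2) 0" and ?v = "vec p x"
  have H: "?H \<in> carrier_mat p p" by (simp add: block_hankel_def)
  have Hidx: "?H $$ (i, l) = fls_nth (S i l) (- 1)" if "i < p" "l < p" for i l
    using that by (simp add: block_hankel_def laurent_mat_index)
  have "(?H *\<^sub>v ?v) \<bullet>c ?v = (\<Sum>a<p. (\<Sum>b<p. ?H $$ (a, b) * x b) * cnj (x a))"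
    using H by (simp add: scalar_prod_def lessThan_atLeast0)
  also have "\<dots> = (\<Sum>a<p. \<Sum>b<p. cnj (x a) * (fls_nth (S a b) (- 1) * x b))"
    unfolding sum_distrib_right by (intro sum.cong refl) (simp add: Hidx mult_ac)
  finally have "(?H *\<^sub>v ?v) \<bullet>c ?v = \<dots>" .
  moreover have "\<forall>v\<in>carrier_vec p. Re ((?H *\<^sub>v v) \<bullet>c v) \<ge> 0"
    using H_nonneg unfolding nonneg_def_mat_def carrier_matD(1)[OF H] by blast
  ultimately show ?thesis using vec_carrier by metis
qed

sublocale hankel_fraction p n S "\<lambda>b c. P $$ (b, c)" "\<lambda>a c. Q $$ (a, c)"
proof
  show "fls_nth (S b a) i = cnj (fls_nth (S a b) i)" if "a < p" "b < p" for a b i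
    unfolding S_eq[OF that] S_eq[OF that(2,1)]
    by (rule fls_quotient_cnj[OF N_conjugate[OF that] d_nonzero])
  show "degree (Q $$ (a, c)) \<le> n + 1" if "a < p" "c < p" for a c
    using degree_le_mpoly_degree[of a Q c] Q that degree_diff by simp
  show "degree (P $$ (b, c)) \<le> n" if "b < p" "c < p" for b c
    using degree_le_mpoly_degree[of b P c] P that by simp
  show "coeff (P $$ (b, c)) n = (if b = c then 1 else 0)" if "b < p" "c < p" for b c
    using monic P that by (rule coeff_monic)
qed (fact degree_pos S_fraction S_hankel_neg S_leading_nonneg)+

section \<open>The assertions on \<open>P\<close>, \<open>Q\<close> and \<open>R\<close>\<close>

lemma mult_vec_index:
  "F \<in> carrier_mat p p \<Longrightarrow> x \<in> carrier_vec p \<Longrightarrow> i < p \<Longrightarrow>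
    (mpoly_eval F z *\<^sub>v x) $ i = (\<Sum>c<p. poly (F $$ (i, c)) z * x $ c)"
  by (simp add: mpoly_eval_def scalar_prod_def lessThan_atLeast0)

lemma zeros_subset_reals: "mpoly_zeros P \<subseteq> \<real>"
proof
  fix z assume "z \<in> mpoly_zeros P"
  then obtain x where x: "x \<in> carrier_vec p" "x \<noteq> 0\<^sub>v p" "mpoly_eval P z *\<^sub>v x = 0\<^sub>v p"
    using det_0_iff_vec_prod_zero_field[of "mpoly_eval P z" p] P by (auto simp: mpoly_zeros_def)
  obtain b where b: "b < p" "x $ b \<noteq> 0" using x by (metis carrier_vecD eq_vecI index_zero_vec)
  have "(\<Sum>c<p. poly (P $$ (b, c)) z * x $ c) = 0" if "b < p" for b
    using mult_vec_index[OF P x(1) that, of z] x(3) that by simp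
  thus "z \<in> \<real>" using b by (rule zeros_real)
qed

lemma simple_P: "mpoly_simple P"
proof -
  have "\<exists>z. poly d z \<noteq> 0" using d_nonzero poly_all_0_iff_0 by blast
  hence "mpoly_regular P" by (auto simp: mpoly_regular_def poly_d)
  moreover have "Polynomial.order z (det P) = kernel_dim (mpoly_eval P z)" for z
  proof (rule order_det_eq_kernel_dim[OF P])
    show "det P \<noteq> 0" using d_nonzero by (simp add: d_def)
    fix x y :: "complex vec"
    assume x: "x \<in> carrier_vec p" and y: "y \<in> carrier_vec p"
      and Px: "mpoly_eval P z *\<^sub>v x = 0\<^sub>v p"
      and chain: "mpoly_eval (map_mat pderiv P) z *\<^sub>v x + mpoly_eval P z *\<^sub>v y = 0\<^sub>v p"
    have "x $ b = 0" if "b < p" for b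
    proof (rule no_Jordan_chain[OF _ _ that])
      fix b assume b: "b < p"
      show "(\<Sum>c<p. poly (P $$ (b, c)) z * x $ c) = 0"
        using mult_vec_index[OF P x b, of z] Px b by simp
      have P': "map_mat pderiv P \<in> carrier_mat p p" using P by simp
      have "(mpoly_eval (map_mat pderiv P) z *\<^sub>v x + mpoly_eval P z *\<^sub>v y) $ b
          = (mpoly_eval (map_mat pderiv P) z *\<^sub>v x) $ b + (mpoly_eval P z *\<^sub>v y) $ b"
        using P b by (intro index_add_vec) (simp add: mpoly_eval_def)
      thus "(\<Sum>c<p. poly (pderiv (P $$ (b, c))) z * x $ c) + (\<Sum>c<p. poly (P $$ (b, c)) z * y $ c) = 0"
        unfolding chain mult_vec_index[OF P y b] mult_vec_index[OF P' x b] using b P by simp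
    qed
    thus "x = 0\<^sub>v p" using x by (intro eq_vecI) auto
  qed
  ultimately show ?thesis by (simp add: mpoly_simple_def)
qed

text \<open>A null vector of \<open>G(z)\<close> is annihilated by every left multiple of
  \<open>G\<close> at \<open>z\<close>, hence by both \<open>Q(z)\<close> and
  \<open>P(z)\<close>.\<close>

lemma right_coprime_Q_P: "right_coprime p Q P"
  unfolding right_coprime_def unimodular_def
proof (intro allI impI notI)
  fix G z assume G: "is_grcd p G Q P" and "det (mpoly_eval G z) = 0"
  then obtain C D where GC: "G \<in> carrier_mat p p" and C: "C \<in> carrier_mat p p" "Q = C * G"
      and D: "D \<in> carrier_mat p p" "P = D * G"
    unfolding is_grcd_def right_common_divisor_def right_divisor_def by blast
  obtain x where x: "x \<in> carrier_vec p" "x \<noteq> 0\<^sub>v p" and Gx: "mpoly_eval G z *\<^sub>v x = 0\<^sub>v p"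
    using det_0_iff_vec_prod_zero_field[of "mpoly_eval G z" p] GC \<open>det (mpoly_eval G z) = 0\<close> by auto
  have null: "(\<Sum>c<p. poly ((A * G) $$ (b, c)) z * x $ c) = 0" if A: "A \<in> carrier_mat p p" and "b < p" for A b
  proof -
    have "mpoly_eval (A * G) z *\<^sub>v x = mpoly_eval A z *\<^sub>v (mpoly_eval G z *\<^sub>v x)"
      unfolding mpoly_eval_mult[OF A GC]
      by (rule assoc_mult_mat_vec[OF mpoly_eval_carrier[OF A] mpoly_eval_carrier[OF GC] x(1)])
    hence "(mpoly_eval (A * G) z *\<^sub>v x) $ b = 0"
      unfolding Gx using A \<open>b < p\<close> by (simp add: mpoly_eval_def)
    thus ?thesis using mult_vec_index[of "A * G" x b z] A GC x \<open>b < p\<close> by simp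
  qed
  have "x $ b = 0" if "b < p" for b
    using no_common_null_vector[of z "($) x" b] null[OF C(1)] null[OF D(1)] that
    by (simp flip: C(2) D(2))
  hence "x = 0\<^sub>v p" using x(1) by (intro eq_vecI) auto
  thus False using x(2) by contradiction
qed

text \<open>If \<open>Q\<close> had smaller degree, s_0 would vanish; but s_0 is the leading
  diagonal block of a negative definite matrix. The constant vector with all entries
  \<open>1\<close> yields the contradiction.\<close>

lemma degree_Q_lower: "n \<le> mpoly_degree Q + 1" if "p \<ge> 1"
proof (rule ccontr)
  assume "\<not> n \<le> mpoly_degree Q + 1"
  hence S1: "fls_nth (S a b) 1 = 0" if "a < p" "b < p" for a b
    using that Q by (intro S_nth_eq_0[of "mpoly_degree Q"] degree_le_mpoly_degree) auto
  have "Re (hankel_form p S (\<lambda>_. 1) (\<lambda>_. 1)) < 0"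
    using that n_pos by (intro S_hankel_neg[of _ 0]) auto
  moreover have "hankel_form p S (\<lambda>_. 1) (\<lambda>_. 1) = 0"
    using poly_at_infinity_const[of 1] by (simp add: hankel_form_def S1 one_pCons cnj_poly_pCons)
  ultimately show False by simp
qed

lemma poly_d_nonzero: "Im z > 0 \<Longrightarrow> poly d z \<noteq> 0"
  using zeros_subset_reals by (auto simp: mpoly_zeros_def poly_d complex_is_Real_iff)

lemma herglotz: "herglotz_nevanlinna p R"
  unfolding herglotz_nevanlinna_def
proof (intro conjI allI impI)
  fix a b assume ab: "a < p" "b < p"
  show "(\<lambda>z. R z $$ (a, b)) holomorphic_on {z. Im z > 0}"
  proof (rule holomorphic_transform)
    show "(\<lambda>z. poly (N $$ (a, b)) z / poly d z) holomorphic_on {z. Im z > 0}"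
      by (intro holomorphic_intros) (auto dest: poly_d_nonzero)
  qed (use ab R_entry poly_d_nonzero in auto)
next
  fix z :: complex assume z: "Im z > 0"
  define M where "M = (1 / (2 * \<i>)) \<cdot>\<^sub>m (R z - mat_adjoint (R z))"
  note d = poly_d_nonzero[OF z]
  have Rz: "R z \<in> carrier_mat p p" using R_times_P(2)[OF d] .
  have M: "M \<in> carrier_mat p p"
    unfolding M_def by (intro smult_carrier_mat minus_carrier_mat mat_adjoint_carrier Rz)
  have Midx: "M $$ (a, b) = (R z $$ (a, b) - cnj (R z $$ (b, a))) / (2 * \<i>)" if "a < p" "b < p" for a b
    using that Rz mat_adjoint_carrier[OF Rz] mat_adjoint_index[OF Rz that]
    by (simp add: M_def)
  have "mat_adjoint M = M"
  proof (rule eq_matI)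
    fix a b assume "a < dim_row M" "b < dim_col M"
    hence ab: "a < p" "b < p" using M by auto
    show "mat_adjoint M $$ (a, b) = M $$ (a, b)"
      unfolding mat_adjoint_index[OF M ab] Midx[OF ab] conjugate_complex_def Midx[OF ab(2,1)]
      by (simp add: field_simps)
  qed (use M mat_adjoint_carrier[OF M] in auto)
  moreover have "Re ((M *\<^sub>v v) \<bullet>c v) \<ge> 0" if v: "v \<in> carrier_vec p" for v
  proof -
    let ?A = "mpoly_eval P z"
    have A: "?A \<in> carrier_mat p p" using P by simp
    note B = mat_inverse_det_nonzero[OF A d[unfolded poly_d]]
    \<comment> \<open>The preimage of \<open>v\<close> under \<open>P(z)\<close> brings an arbitrary
      \<open>v\<close> into the form \<open>P(z) x\<close> required by
      \<open>Im_nonneg\<close>.\<close>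
    define x where "x = the (mat_inverse ?A) *\<^sub>v v"
    have x: "x \<in> carrier_vec p" unfolding x_def using B(3) v by simp
    have Ax: "?A *\<^sub>v x = v"
      unfolding x_def using assoc_mult_mat_vec[OF A B(3) v] B(1) v by simp
    have Rv: "R z *\<^sub>v v = mpoly_eval Q z *\<^sub>v x"
      using assoc_mult_mat_vec[OF Rz A x] by (simp add: Ax R_times_P(1)[OF d])
    let ?q = "\<Sum>a<p. cnj (v $ a) * (\<Sum>b<p. R z $$ (a, b) * v $ b)"
    have "Im (\<Sum>a<p. cnj (\<Sum>c<p. poly (P $$ (a, c)) z * x $ c) * (\<Sum>c<p. poly (Q $$ (a, c)) z * x $ c)) \<ge> 0"
      by (rule Im_nonneg[OF z])
    also have "(\<Sum>a<p. cnj (\<Sum>c<p. poly (P $$ (a, c)) z * x $ c) * (\<Sum>c<p. poly (Q $$ (a, c)) z * x $ c)) = ?q"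
    proof (intro sum.cong refl)
      fix a assume "a \<in> {..<p}"
      hence a: "a < p" by simp
      have "(R z *\<^sub>v v) $ a = (\<Sum>b<p. R z $$ (a, b) * v $ b)"
        using Rz v a by (simp add: scalar_prod_def lessThan_atLeast0)
      thus "cnj (\<Sum>c<p. poly (P $$ (a, c)) z * x $ c) * (\<Sum>c<p. poly (Q $$ (a, c)) z * x $ c)
          = cnj (v $ a) * (\<Sum>b<p. R z $$ (a, b) * v $ b)"
        using mult_vec_index[OF P x a, of z] mult_vec_index[OF Q x a, of z] by (simp only: Ax Rv)
    qed
    finally have q: "Im ?q \<ge> 0" .
    \<comment> \<open>The remaining computation is \<open>v^* M v = Im (v^* R(z) v)\<close>:
      swapping the summation indices turns the adjoint term into the conjugate of
      \<open>?q\<close>.\<close>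
    have "(M *\<^sub>v v) \<bullet>c v = (\<Sum>a<p. (\<Sum>b<p. M $$ (a, b) * v $ b) * cnj (v $ a))"
      using M v by (simp add: scalar_prod_def lessThan_atLeast0 del: index_smult_mat)
    also have "\<dots> = (\<Sum>a<p. \<Sum>b<p. (cnj (v $ a) * (R z $$ (a, b) * v $ b)
        - cnj (cnj (v $ b) * (R z $$ (b, a) * v $ a))) / (2 * \<i>))"
      unfolding sum_distrib_right by (intro sum.cong refl) (simp add: Midx field_simps)
    also have "\<dots> = (?q - (\<Sum>a<p. \<Sum>b<p. cnj (cnj (v $ b) * (R z $$ (b, a) * v $ a)))) / (2 * \<i>)"
      by (simp only: sum_divide_distrib[symmetric] sum_subtractf sum_distrib_left)
    also have "(\<Sum>a<p. \<Sum>b<p. cnj (cnj (v $ b) * (R z $$ (b, a) * v $ a))) = cnj ?q"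
      by (subst sum.swap) (simp add: sum_distrib_left)
    also have "(?q - cnj ?q) / (2 * \<i>) = of_real (Im ?q)"
      by (rule diff_cnj_divide_2i)
    finally show ?thesis using q by simp
  qed
  ultimately show "nonneg_def_mat ((1 / (2 * \<i>)) \<cdot>\<^sub>m (R z - mat_adjoint (R z)))"
    using M unfolding M_def[symmetric] nonneg_def_mat_def self_adjoint_mat_def by auto
qed

end

theorem theorem1p2:
  fixes p :: nat
    and R :: "complex \<Rightarrow> complex mat"
    and Q P :: "complex poly mat"
  assumes "p \<ge> 1"
    and "rational_mat_function p R"
    and "self_adjoint_mat_function p R"
    and "Q \<in> carrier_mat p p"
    and "P \<in> carrier_mat p p"
    and "mpoly_monic P"
    and "mpoly_degree P \<ge> 1"
    and "\<forall>z. z \<notin> mpoly_zeros P \<longrightarrow>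
           R z = mpoly_eval Q z * the (mat_inverse (mpoly_eval P z))"
    and "nonneg_def_mat (block_hankel p R (- 2) 0)"
    and "neg_def_mat (block_hankel p R 0 (mpoly_degree P - 1))"
    and "int (mpoly_degree Q) - int (mpoly_degree P) \<le> 1"
  shows "herglotz_nevanlinna p R
    \<and> \<bar>int (mpoly_degree Q) - int (mpoly_degree P)\<bar> \<le> 1
    \<and> (mpoly_simple P \<and> mpoly_zeros P \<subseteq> \<real>)
    \<and> right_coprime p Q P"
proof -
  interpret matrix_fraction p R Q P
    using assms by unfold_locales
  show ?thesis
    using herglotz degree_Q_lower[OF assms(1)] degree_diff simple_P zeros_subset_reals
      right_coprime_Q_P by auto
qed

end
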